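(* Let $f\in H_{1/2}(G_m)$ and let $\{q_k:k\ge0\}$ be a non-decreasing sequence of nonnegative numbers with $q_0>0$, $Q_n\to\infty$, satisfying $$\frac{q_{n-1}}{Q_n}=O\!\left(\frac1n\right)\quad (n\to\infty).$$ Then there is an absolute constant $c$ such that for all $n\ge 2$ $$\frac{1}{\log n}\sum_{k=1}^{n}\frac{\|t_kf\|_{1/2}^{1/2}}{k}\le c\,\|f\|_{H_{1/2}}^{1/2}.$$
   Context: Let $m=(m_0,m_1,\dots)$ be a bounded sequence of integers $m_k\ge 2$. $G_m$ is the complete direct product of the cyclic groups $Z_{m_k}=\{0,\dots,m_k-1\}$, with Haar probability measure $\mu$. Elements are $x=(x_0,x_1,\dots)$. $M_0=1$, $M_{k+1}=m_kM_k$; $n=\sum_j n_jM_j$ uniquely with $n_j\in Z_{m_j}$. $I_n(x)=\{y: y_0=x_0,\dots,y_{n-1}=x_{n-1}\}$, $\mathcal F_n$ the $\sigma$-algebra generated by these. $r_k(x)=\exp(2\pi i x_k/m_k)$, $\psi_n=\prod_k r_k^{n_k}$. For a martingale $f=(f^{(n)})$ w.r.t. $(\mathcal F_n)$, $\hat f(i)=\lim_k\int f^{(k)}\overline{\psi_i}\,d\mu$, $S_nf=\sum_{k=0}^{n-1}\hat f(k)\psi_k$. $H_p$ consists of martingales with $\|f\|_{H_p}:=\|\sup_n|f^{(n)}|\|_p<\infty$. $Q_n:=\sum_{k=0}^{n-1}q_k$, and the Nörlund mean is $t_nf=\frac1{Q_n}\sum_{k=1}^n q_{n-k}S_kf$.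 *)

theory Defs
  imports "HOL-Probability.Probability" "HOL-Library.Landau_Symbols"
begin

definition vilenkin_space :: "(nat \<Rightarrow> nat) \<Rightarrow> (nat \<Rightarrow> nat) set" where
  "vilenkin_space m = {x. \<forall>k. x k < m k}"

definition haar :: "(nat \<Rightarrow> nat) \<Rightarrow> (nat \<Rightarrow> nat) measure" where
  "haar m = PiM UNIV (\<lambda>k. uniform_count_measure {..<m k})"

definition Mseq :: "(nat \<Rightarrow> nat) \<Rightarrow> nat \<Rightarrow> nat" where
  "Mseq m k = (\<Prod>j<k. m j)"

definition digit :: "(nat \<Rightarrow> nat) \<Rightarrow> nat \<Rightarrow> nat \<Rightarrow> nat" where
  "digit m n j = (n div Mseq m j) mod m j"

text \<open>Generalized Rademacher functions r_k and Vilenkin functions psi_n.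
  Since M_k >= 2^k > k, all digits n_k with k >= n vanish, so the product over k < n is the full product.\<close>
definition rk :: "(nat \<Rightarrow> nat) \<Rightarrow> nat \<Rightarrow> (nat \<Rightarrow> nat) \<Rightarrow> complex" where
  "rk m k x = exp (2 * pi * \<i> * of_nat (x k) / of_nat (m k))"

definition psi :: "(nat \<Rightarrow> nat) \<Rightarrow> nat \<Rightarrow> (nat \<Rightarrow> nat) \<Rightarrow> complex" where
  "psi m n x = (\<Prod>k<n. rk m k x ^ digit m n k)"

text \<open>Martingales with respect to (F_n), F_n generated by the intervals I_n(x):
  f n is F_n-measurable (depends only on x_0,...,x_{n-1}) and
  E(f (n+1) | F_n) = f n, i.e. f n is the average of f (n+1) over each I_n(x).\<close>
definition vmartingale :: "(nat \<Rightarrow> nat) \<Rightarrow> (nat \<Rightarrow> (nat \<Rightarrow> nat) \<Rightarrow> complex) \<Rightarrow> bool" where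
  "vmartingale m f \<longleftrightarrow>
     (\<forall>n. \<forall>x\<in>vilenkin_space m. \<forall>y\<in>vilenkin_space m. (\<forall>j<n. x j = y j) \<longrightarrow> f n x = f n y) \<and>
     (\<forall>n. \<forall>x\<in>vilenkin_space m.
        f n x = (\<Sum>j<m n. f (Suc n) (x(n := j))) / of_nat (m n))"

definition fourier_coeff :: "(nat \<Rightarrow> nat) \<Rightarrow> (nat \<Rightarrow> (nat \<Rightarrow> nat) \<Rightarrow> complex) \<Rightarrow> nat \<Rightarrow> complex" where
  "fourier_coeff m f i = lim (\<lambda>k. \<integral>x. f k x * cnj (psi m i x) \<partial>haar m)"

definition partial_sum :: "(nat \<Rightarrow> nat) \<Rightarrow> (nat \<Rightarrow> (nat \<Rightarrow> nat) \<Rightarrow> complex) \<Rightarrow> nat \<Rightarrow> (nat \<Rightarrow> nat) \<Rightarrow> complex" where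
  "partial_sum m f n x = (\<Sum>k<n. fourier_coeff m f k * psi m k x)"

definition Qsum :: "(nat \<Rightarrow> real) \<Rightarrow> nat \<Rightarrow> real" where
  "Qsum q n = (\<Sum>k<n. q k)"

definition norlund_mean :: "(nat \<Rightarrow> nat) \<Rightarrow> (nat \<Rightarrow> real) \<Rightarrow> (nat \<Rightarrow> (nat \<Rightarrow> nat) \<Rightarrow> complex) \<Rightarrow> nat \<Rightarrow> (nat \<Rightarrow> nat) \<Rightarrow> complex" where
  "norlund_mean m q f n x = (\<Sum>k=1..n. of_real (q (n - k)) * partial_sum m f k x) / of_real (Qsum q n)"

definition lp_norm :: "(nat \<Rightarrow> nat) \<Rightarrow> real \<Rightarrow> ((nat \<Rightarrow> nat) \<Rightarrow> complex) \<Rightarrow> real" where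
  "lp_norm m p g = (\<integral>x. cmod (g x) powr p \<partial>haar m) powr (1 / p)"

text \<open>int (sup_n |f^(n)|)^p d mu, written as int sup_n |f^(n)|^p d mu (t -> t^p is increasing).\<close>
definition hp_integral :: "(nat \<Rightarrow> nat) \<Rightarrow> real \<Rightarrow> (nat \<Rightarrow> (nat \<Rightarrow> nat) \<Rightarrow> complex) \<Rightarrow> ennreal" where
  "hp_integral m p f = (\<integral>\<^sup>+x. (SUP n. ennreal (cmod (f n x) powr p)) \<partial>haar m)"

definition in_Hp :: "(nat \<Rightarrow> nat) \<Rightarrow> real \<Rightarrow> (nat \<Rightarrow> (nat \<Rightarrow> nat) \<Rightarrow> complex) \<Rightarrow> bool" where
  "in_Hp m p f \<longleftrightarrow> vmartingale m f \<and> hp_integral m p f < \<infinity>"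

definition hp_norm :: "(nat \<Rightarrow> nat) \<Rightarrow> real \<Rightarrow> (nat \<Rightarrow> (nat \<Rightarrow> nat) \<Rightarrow> complex) \<Rightarrow> real" where
  "hp_norm m p f = enn2real (hp_integral m p f) powr (1 / p)"

end

theory Submission
  imports Defs
begin

text \<open>
  Only the first \<open>R\<close> coordinates matter for \<open>t\<^sub>k f\<close> with \<open>k \<le> M\<^sub>R\<close>, so all integrals are finite averages.
  Splitting sums of characters into blocks of length \<open>M\<^sub>s\<^sub>+\<^sub>1\<close> shows that the Fejer kernels satisfy
  \<open>k |K\<^sub>k(x, t)| \<le> C M\<^sub>s M\<^sub>l\<close> when \<open>x\<close> and \<open>t\<close> first differ at the positions \<open>s < l\<close>; by Abel summation and
  \<open>q\<^sub>n\<^sub>-\<^sub>1 / Q\<^sub>n = O(1/n)\<close> the Noerlund kernels inherit this bound with an extra factor \<open>1/k\<close>.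

  For an atom \<open>a\<close> with mean zero on an interval \<open>I\<close> of order \<open>N\<close>, \<open>|a| \<le> A\<close>, the means \<open>t\<^sub>k a\<close> vanish for
  \<open>k \<le> M\<^sub>N\<close>. For larger \<open>k\<close> the integral of \<open>|t\<^sub>k a|\<^sup>1\<^sup>/\<^sup>2\<close> is at most \<open>C A\<^sup>1\<^sup>/\<^sup>2 / M\<^sub>N\<close> over \<open>I\<close> and
  \<open>C A\<^sup>1\<^sup>/\<^sup>2 / M\<^sub>N * log k * (M\<^sub>N / k)\<^sup>1\<^sup>/\<^sup>2\<close> off \<open>I\<close>, so that the weights \<open>1/k\<close> sum to \<open>C A\<^sup>1\<^sup>/\<^sup>2 / M\<^sub>N * log n\<close>.

  A martingale is the sum of the differences of its stopped versions at the dyadic thresholds, and each of these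
  is a sum of atoms. Since \<open>u \<mapsto> |u|\<^sup>1\<^sup>/\<^sup>2\<close> is subadditive, the contributions add up to
  \<open>C log n\<close> times the integral of the square root of the maximal function.
\<close>

section \<open>Character sums\<close>

locale vilenkin =
  fixes m :: "nat \<Rightarrow> nat" and B :: nat
  assumes m_ge2: "m k \<ge> 2" and m_le: "m k \<le> B"
begin

abbreviation M :: "nat \<Rightarrow> nat" where "M \<equiv> Mseq m"

lemma m_pos: "m k > 0"
  using m_ge2[of k] by linarith

lemma M_Suc: "M (Suc k) = M k * m k"
  by (simp add: Mseq_def)

lemma M_0: "M 0 = 1"
  by (simp add: Mseq_def)

lemma M_pos: "M k > 0"
  by (auto simp: Mseq_def m_pos intro!: prod_pos)

lemma M_Suc_ge: "M (Suc k) \<ge> 2 * M k"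
  using mult_le_mono2[OF m_ge2[of k], of "M k"] by (simp add: M_Suc mult.commute)

lemma M_Suc_le: "M (Suc k) \<le> B * M k"
  using mult_le_mono2[OF m_le[of k], of "M k"] by (simp add: M_Suc mult.commute)

lemma M_mono: "i \<le> j \<Longrightarrow> M i \<le> M j"
proof (rule lift_Suc_mono_le[of M])
  show "M n \<le> M (Suc n)" for n using M_Suc_ge[of n] by linarith
qed

lemma M_ge_power: "2 ^ k \<le> M k"
proof (induction k)
  case (Suc k) then show ?case using M_Suc_ge[of k] by simp
qed (simp add: M_0)

lemma less_M: "k < M k"
  using M_ge_power[of k] less_exp[of k] by linarith

lemma M_dvd: "i \<le> j \<Longrightarrow> M i dvd M j"
  unfolding Mseq_def by (rule prod_dvd_prod_subset) auto

lemma digit_eq_0: "n < M j \<Longrightarrow> digit m n j = 0"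
  by (simp add: digit_def)

text \<open>\<open>M K\<close> is a multiple of \<open>M (Suc j)\<close>, so the added term changes
  the quotient by \<open>M j\<close> only by a multiple of \<open>m j\<close>.\<close>

lemma digit_add_low: "j < K \<Longrightarrow> digit m (b * M K + u) j = digit m u j"
proof -
  assume "j < K"
  then have "M (Suc j) dvd M K" by (intro M_dvd) simp
  then obtain c where c: "M K = M j * (m j * c)" unfolding M_Suc dvd_def mult.assoc by blast
  have "b * M K + u = M j * (m j * (b * c)) + u" unfolding c by (simp add: ac_simps)
  then have "(b * M K + u) div M j = m j * (b * c) + u div M j"
    using M_pos[of j] by (simp only: div_mult_self4[OF less_imp_neq[THEN not_sym]])
  then show ?thesis by (simp add: digit_def)
qed

lemma digit_add_high: "K \<le> j \<Longrightarrow> u < M K \<Longrightarrow> digit m (b * M K + u) j = digit m (b * M K) j"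
proof -
  assume "K \<le> j" and u: "u < M K"
  then obtain c where c: "M j = M K * c" using M_dvd[of K j] by (metis dvdE)
  have "(b * M K + u) div M j = ((b * M K + u) div M K) div c"
    unfolding c by (rule div_mult2_eq)
  also have "(b * M K + u) div M K = b * M K div M K" using u by simp
  also have "\<dots> div c = b * M K div M j" unfolding c by (rule div_mult2_eq[symmetric])
  finally have "(b * M K + u) div M j = (b * M K) div M j" .
  then show ?thesis by (simp add: digit_def)
qed

text \<open>A Vilenkin function with the Rademacher values replaced by free parameters. This covers
  psi_i(x) as well as psi_i(x) times the conjugate of psi_i(t), and it allows single coordinates to
  be altered.\<close>

definition chi :: "(nat \<Rightarrow> complex) \<Rightarrow> nat \<Rightarrow> complex" where
  "chi w i = (\<Prod>k<i. w k ^ digit m i k)"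

lemma psi_eq_chi: "psi m i x = chi (\<lambda>k. rk m k x) i"
  by (simp add: psi_def chi_def)

text \<open>Both ranges contain all nonzero digits of \<open>i\<close>: those at
  \<open>k \<ge> K\<close> vanish since \<open>i < M K \<le> M k\<close>, those at
  \<open>k \<ge> i\<close> since \<open>i \<le> k < M k\<close>.\<close>

lemma chi_upto:
  assumes "i < M K"
  shows "chi w i = (\<Prod>k<K. w k ^ digit m i k)"
proof -
  have z: "digit m i k = 0" if "min i K \<le> k" for k
  proof (cases "i \<le> k")
    case True
    then show ?thesis using less_M[of k] by (intro digit_eq_0) linarith
  next
    case False
    then have "M K \<le> M k" using that by (intro M_mono) auto
    then show ?thesis using assms by (intro digit_eq_0) linarith
  qed
  have "chi w i = (\<Prod>k<min i K. w k ^ digit m i k)"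
    unfolding chi_def by (rule prod.mono_neutral_right) (auto simp: z)
  also have "\<dots> = (\<Prod>k<K. w k ^ digit m i k)"
    by (rule prod.mono_neutral_left) (auto simp: z)
  finally show ?thesis .
qed

text \<open>There are no carries: below position \<open>K\<close> the digits are those of
  \<open>u\<close>, from \<open>K\<close> on those of \<open>b * M K\<close>.\<close>

lemma chi_block:
  assumes "u < M K"
  shows "chi w (b * M K + u) = chi w (b * M K) * chi w u"
proof -
  define L where "L = b * M K + u + K"
  have L: "b * M K + u < M L" "b * M K < M L" "u < M L" "K \<le> L"
    using less_M[of L] by (auto simp: L_def)
  have "w k ^ digit m (b * M K + u) k = w k ^ digit m (b * M K) k * w k ^ digit m u k" for k
  proof (cases "k < K")
    case True
    then show ?thesis
      using digit_add_low[of k K b u] digit_add_low[of k K b 0] by (simp add: digit_def)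
  next
    case False
    then have "digit m u k = 0" using M_mono[of K k] assms by (intro digit_eq_0) linarith
    then show ?thesis using False digit_add_high[of K k u b] assms by simp
  qed
  then show ?thesis by (simp add: chi_upto[OF L(1)] chi_upto[OF L(2)] chi_upto[OF L(3)] prod.distrib)
qed

lemma chi_cong:
  assumes "i < M K" "\<And>k. k < K \<Longrightarrow> w k = w' k"
  shows "chi w i = chi w' i"
proof -
  have "(\<Prod>k<K. w k ^ digit m i k) = (\<Prod>k<K. w' k ^ digit m i k)"
    by (rule prod.cong[OF refl]) (simp add: assms(2))
  then show ?thesis by (simp only: chi_upto[OF assms(1)])
qed

lemma chi_mult_M: 
  assumes "a < m K" shows "chi w (a * M K) = w K ^ a"
proof -
  have "a * M K < M (Suc K)" using assms M_pos[of K] by (simp add: M_Suc)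
  then have "chi w (a * M K) = (\<Prod>k<K. w k ^ digit m (a * M K) k) * w K ^ digit m (a * M K) K"
    by (simp add: chi_upto[of "a * M K" "Suc K"])
  moreover have "digit m (a * M K) k = 0" if "k < K" for k
    using digit_add_low[OF that, of a 0] by (simp add: digit_def)
  moreover have "digit m (a * M K) K = a" using assms M_pos[of K] by (simp add: digit_def)
  ultimately show ?thesis by simp
qed

lemma norm_chi: "(\<And>k. cmod (w k) = 1) \<Longrightarrow> cmod (chi w i) = 1"
  by (simp add: chi_def norm_power flip: prod_norm)

section \<open>Dirichlet kernels and their sums\<close>

definition dirichlet :: "(nat \<Rightarrow> complex) \<Rightarrow> nat \<Rightarrow> complex" where
  "dirichlet w k = (\<Sum>i<k. chi w i)"

lemma sum_split_block:
  fixes g :: "nat \<Rightarrow> 'a::comm_monoid_add"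
  shows "(\<Sum>i<b * K + v. g i) = (\<Sum>a<b. \<Sum>u<K. g (a * K + u)) + (\<Sum>u<v. g (b * K + u))"
proof -
  have "(\<Sum>i<b * K + v. g i) = (\<Sum>i<b * K. g i) + (\<Sum>u<v. g (b * K + u))"
    by (induction v) (auto simp: add.assoc)
  moreover have "(\<Sum>i<b * K. g i) = (\<Sum>a<b. \<Sum>u<K. g (a * K + u))"
  proof (induction b)
    case (Suc b)
    have "(\<Sum>i<b * K + v. g i) = (\<Sum>i<b * K. g i) + (\<Sum>u<v. g (b * K + u))" for v
      by (induction v) (auto simp: add.assoc)
    from this[of K] Suc show ?case by (simp add: add.commute)
  qed simp
  ultimately show ?thesis by simp
qed

lemma sum_root_of_unity: "(z::complex) \<noteq> 1 \<Longrightarrow> z ^ n = 1 \<Longrightarrow> (\<Sum>a<n. z ^ a) = 0"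
  by (simp add: geometric_sum)

text \<open>The digit at \<open>s\<close> runs through all its values independently of the lower
  digits, so a full geometric sum of a nontrivial root of unity splits off.\<close>

lemma dirichlet_M_eq_0:
  assumes "w s \<noteq> 1" "w s ^ m s = 1"
  shows "dirichlet w (M (Suc s)) = 0"
proof -
  have "dirichlet w (M (Suc s)) = (\<Sum>a<m s. \<Sum>u<M s. chi w (a * M s + u))"
    using sum_split_block[of "chi w" "m s" "M s" 0] by (simp add: dirichlet_def M_Suc mult.commute)
  also have "\<dots> = (\<Sum>a<m s. w s ^ a) * dirichlet w (M s)"
    by (simp add: chi_block chi_mult_M dirichlet_def sum_product)
  finally show ?thesis using assms by (simp add: sum_root_of_unity)
qed

text \<open>Every complete block of length \<open>M (Suc s)\<close> sums to zero, which leaves only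
  the last, incomplete block.\<close>

lemma dirichlet_block:
  assumes "w s \<noteq> 1" "w s ^ m s = 1" "u < M (Suc s)"
  shows "dirichlet w (b * M (Suc s) + u) = chi w (b * M (Suc s)) * dirichlet w u"
proof -
  have "dirichlet w (b * M (Suc s) + u) = (\<Sum>a<b. \<Sum>v<M (Suc s). chi w (a * M (Suc s) + v))
      + (\<Sum>v<u. chi w (b * M (Suc s) + v))"
    unfolding dirichlet_def by (rule sum_split_block)
  also have "(\<Sum>a<b. \<Sum>v<M (Suc s). chi w (a * M (Suc s) + v)) = (\<Sum>a<b. chi w (a * M (Suc s)) * dirichlet w (M (Suc s)))"
    by (simp add: chi_block dirichlet_def sum_distrib_left)
  also have "\<dots> = 0" using dirichlet_M_eq_0[where w = w and s = s] assms(1,2) by simp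
  also have "(\<Sum>v<u. chi w (b * M (Suc s) + v)) = chi w (b * M (Suc s)) * dirichlet w u"
    using assms(3) by (simp add: chi_block dirichlet_def sum_distrib_left)
  finally show ?thesis by simp
qed

lemma norm_dirichlet_le: "(\<And>k. cmod (w k) = 1) \<Longrightarrow> cmod (dirichlet w k) \<le> real k"
  unfolding dirichlet_def by (rule order.trans[OF norm_sum]) (simp add: norm_chi)

lemma norm_sum_dirichlet_le:
  assumes "\<And>k. cmod (w k) = 1"
  shows "cmod (\<Sum>k<j. dirichlet w k) \<le> real j * real j"
proof -
  have "cmod (\<Sum>k<j. dirichlet w k) \<le> (\<Sum>k<j. real j)"
  proof (rule sum_norm_le)
    fix k assume "k \<in> {..<j}"
    then show "cmod (dirichlet w k) \<le> real j" using norm_dirichlet_le[of w k] assms by simp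
  qed
  then show ?thesis by simp
qed

lemma dirichlet_bound:
  assumes "\<And>k. cmod (w k) = 1" "w s \<noteq> 1" "w s ^ m s = 1"
  shows "cmod (dirichlet w k) \<le> M (Suc s)"
proof -
  define b u where "b = k div M (Suc s)" and "u = k mod M (Suc s)"
  have k: "k = b * M (Suc s) + u" "u < M (Suc s)" unfolding b_def u_def by (simp_all only: div_mult_mod_eq mod_less_divisor M_pos)
  have "cmod (dirichlet w k) = cmod (dirichlet w u)"
    using dirichlet_block[where w = w and s = s and b = b, OF assms(2,3) k(2)] norm_chi[OF assms(1)] by (simp add: norm_mult flip: k(1))
  then show ?thesis using norm_dirichlet_le[of w u] assms(1) k(2) by force
qed

text \<open>Setting the coordinates up to \<open>s\<close> to 1 turns \<open>dirichlet\<close> into \<open>M (Suc s)\<close> times the sum over the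
  block leaders, which makes the Dirichlet bound available for the latter.\<close>
lemma sum_block_leaders_bound:
  assumes w: "\<And>k. cmod (w k) = 1" and l: "s < l" "w l \<noteq> 1" "w l ^ m l = 1"
  shows "M (Suc s) * cmod (\<Sum>a<b. chi w (a * M (Suc s))) \<le> M (Suc l)"
proof -
  define v where "v k = (if k \<le> s then 1 else w k)" for k
  have low: "chi v u = 1" if "u < M (Suc s)" for u
    using that by (simp add: chi_upto[of u "Suc s"] v_def)
  have high: "chi v (a * M (Suc s)) = chi w (a * M (Suc s))" for a
  proof -
    define L where "L = a * M (Suc s)"
    have "v k ^ digit m L k = w k ^ digit m L k" for k
      using digit_add_low[of k "Suc s" a 0] by (auto simp: L_def v_def less_Suc_eq_le digit_def)
    then show ?thesis unfolding chi_def L_def by (intro prod.cong) auto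
  qed
  have "dirichlet v (b * M (Suc s)) = of_nat (M (Suc s)) * (\<Sum>a<b. chi w (a * M (Suc s)))"
    using sum_split_block[of "chi v" b "M (Suc s)" 0]
    by (simp add: dirichlet_def chi_block low high sum_distrib_left)
  moreover have "cmod (dirichlet v (b * M (Suc s))) \<le> M (Suc l)"
    by (rule dirichlet_bound) (use w l in \<open>auto simp: v_def\<close>)
  ultimately show ?thesis by (simp add: norm_mult)
qed

text \<open>Complete blocks contribute the sum of their leading characters times the sum of
  \<open>dirichlet w u\<close> over \<open>u < K\<close>. The latter sum and the incomplete block
  are both bounded trivially by the square of \<open>K\<close>. One factor \<open>K\<close> stays
  attached to the leader sum because that product is what gets estimated next.\<close>

lemma sum_dirichlet_split:
  assumes w: "\<And>k. cmod (w k) = 1" and s: "w s \<noteq> 1" "w s ^ m s = 1"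
  defines "K \<equiv> M (Suc s)"
  shows "cmod (\<Sum>k<j. dirichlet w k) \<le> real K * (K * cmod (\<Sum>a<j div K. chi w (a * K))) + real K * real K"
proof -
  define b v where "b = j div K" and "v = j mod K"
  have j: "j = b * K + v" "v < K" unfolding b_def v_def K_def by (simp_all only: div_mult_mod_eq mod_less_divisor M_pos)
  have "(\<Sum>k<j. dirichlet w k) = (\<Sum>a<b. chi w (a * K)) * (\<Sum>u<K. dirichlet w u) + chi w (b * K) * (\<Sum>u<v. dirichlet w u)"
    unfolding j(1) sum_split_block sum_product
    using j(2) by (simp add: dirichlet_block[where w = w and s = s, OF s] K_def sum_distrib_left)
  then have "cmod (\<Sum>k<j. dirichlet w k) \<le> cmod (\<Sum>a<b. chi w (a * K)) * cmod (\<Sum>u<K. dirichlet w u) + cmod (\<Sum>u<v. dirichlet w u)"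
    using norm_triangle_ineq[of "(\<Sum>a<b. chi w (a * K)) * (\<Sum>u<K. dirichlet w u)" "chi w (b * K) * (\<Sum>u<v. dirichlet w u)"]
    by (simp add: norm_mult norm_chi[OF w])
  also have "\<dots> \<le> cmod (\<Sum>a<b. chi w (a * K)) * (real K * real K) + real K * real K"
  proof (rule add_mono[OF mult_left_mono[OF norm_sum_dirichlet_le[of w K, OF w]]])
    have "cmod (\<Sum>u<v. dirichlet w u) \<le> real v * real v" by (rule norm_sum_dirichlet_le[OF w])
    also have "\<dots> \<le> real K * real K" using j(2) by (intro mult_mono) auto
    finally show "cmod (\<Sum>u<v. dirichlet w u) \<le> real K * real K" .
  qed auto
  finally show ?thesis by (simp add: b_def algebra_simps)
qed

lemma fejer_bound_two:
  assumes w: "\<And>k. cmod (w k) = 1" and s: "w s \<noteq> 1" "w s ^ m s = 1"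
    and l: "s < l" "w l \<noteq> 1" "w l ^ m l = 1"
  shows "cmod (\<Sum>k<j. dirichlet w k) \<le> 2 * real (M (Suc s)) * real (M (Suc l))"
proof -
  have "cmod (\<Sum>k<j. dirichlet w k) \<le> real (M (Suc s)) * real (M (Suc l)) + real (M (Suc s)) * real (M (Suc s))"
    by (rule order.trans[OF sum_dirichlet_split[where w = w and s = s and j = j, OF w s]])
       (intro add_mono mult_left_mono sum_block_leaders_bound w l, auto)
  moreover have "real (M (Suc s)) * real (M (Suc s)) \<le> real (M (Suc s)) * real (M (Suc l))"
    using M_mono[of "Suc s" "Suc l"] l by (intro mult_left_mono) auto
  ultimately show ?thesis by simp
qed

text \<open>With only one nontrivial parameter known, the leader sum is bounded by its number of
  terms, and \<open>K\<close> times this number is at most \<open>j\<close>. The range up to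
  \<open>Suc (M r)\<close> is the one that summation by parts for indices \<open>k \<le> M r\<close>
  produces.\<close>

lemma fejer_bound_one:
  assumes w: "\<And>k. cmod (w k) = 1" and s: "w s \<noteq> 1" "w s ^ m s = 1"
    and r: "s < r" "j \<le> Suc (M r)"
  shows "cmod (\<Sum>k<j. dirichlet w k) \<le> 3 * real (M (Suc s)) * real (M r)"
proof -
  define K where "K = M (Suc s)"
  have "cmod (\<Sum>a<j div K. chi w (a * K)) \<le> real (j div K)"
    by (rule order.trans[OF norm_sum]) (simp add: norm_chi[OF w])
  then have "real K * cmod (\<Sum>a<j div K. chi w (a * K)) \<le> real K * real (j div K)"
    by (rule mult_left_mono) simp
  also have "\<dots> \<le> real j" by (metis div_times_less_eq_dividend mult.commute of_nat_le_iff of_nat_mult)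
  also have "\<dots> \<le> 2 * real (M r)" using r M_pos[of r] by linarith
  finally have *: "real K * cmod (\<Sum>a<j div K. chi w (a * K)) \<le> 2 * real (M r)" .
  have "cmod (\<Sum>k<j. dirichlet w k) \<le> real K * (K * cmod (\<Sum>a<j div K. chi w (a * K))) + real K * real K"
    using sum_dirichlet_split[where w = w and s = s and j = j, OF w s] by (simp add: K_def)
  also have "\<dots> \<le> real K * (2 * real (M r)) + real K * real (M r)"
    using * M_mono[of "Suc s" r] r by (intro add_mono mult_left_mono) (auto simp: K_def)
  finally show ?thesis by (simp add: K_def algebra_simps)
qed

end

section \<open>Pointwise bounds for the Noerlund kernels\<close>

text \<open>Summation by parts: the differences of a decreasing weight are nonnegative, so their
  total telescopes and only the first weight remains.\<close>

lemma abel_bound: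
  fixes c :: "nat \<Rightarrow> real" and d :: "nat \<Rightarrow> complex"
  assumes c: "antimono c" "\<And>i. c i \<ge> 0" and U: "\<And>j. j \<le> k \<Longrightarrow> cmod (\<Sum>i<j. d i) \<le> U"
  shows "cmod (\<Sum>i<k. c i * d i) \<le> c 0 * U"
proof -
  \<comment> \<open>The boundary term is split off so that the induction adds exactly one
    nonnegative difference \<open>c j - c (Suc j)\<close> per step.\<close>
  have "j \<le> k \<Longrightarrow> cmod ((\<Sum>i<j. c i * d i) - c j * (\<Sum>i<j. d i)) \<le> (c 0 - c j) * U" for j
  proof (induction j)
    case (Suc j)
    have "(\<Sum>i<Suc j. c i * d i) - c (Suc j) * (\<Sum>i<Suc j. d i)
       = ((\<Sum>i<j. c i * d i) - c j * (\<Sum>i<j. d i)) + of_real (c j - c (Suc j)) * (\<Sum>i<Suc j. d i)"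
      by (simp add: algebra_simps)
    also have "cmod \<dots> \<le> (c 0 - c j) * U + cmod (of_real (c j - c (Suc j)) * (\<Sum>i<Suc j. d i))"
      using Suc by (intro norm_triangle_le add_mono) auto
    also have "cmod (of_real (c j - c (Suc j)) * (\<Sum>i<Suc j. d i)) = (c j - c (Suc j)) * cmod (\<Sum>i<Suc j. d i)"
      using antimonoD[OF c(1), of j "Suc j"] unfolding norm_mult norm_of_real by simp
    also have "\<dots> \<le> (c j - c (Suc j)) * U"
      using antimonoD[OF c(1), of j "Suc j"] U[OF Suc.prems] by (intro mult_left_mono) auto
    finally show ?case by (simp add: algebra_simps)
  qed simp
  from this[of k] have 1: "cmod ((\<Sum>i<k. c i * d i) - c k * (\<Sum>i<k. d i)) \<le> (c 0 - c k) * U" by simp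
  have 2: "cmod (c k * (\<Sum>i<k. d i)) \<le> c k * U"
    using c U[of k] by (simp add: norm_mult mult_left_mono)
  have "(\<Sum>i<k. c i * d i) = ((\<Sum>i<k. c i * d i) - c k * (\<Sum>i<k. d i)) + c k * (\<Sum>i<k. d i)" by simp
  then have "cmod (\<Sum>i<k. c i * d i) \<le> (c 0 - c k) * U + c k * U"
    using norm_triangle_mono[OF 1 2] by simp
  then show ?thesis by (simp add: algebra_simps)
qed

section \<open>The finite model: the first \<open>R\<close> coordinates, cylinders and their
  cardinalities\<close>

context vilenkin
begin

text \<open>One representative for each interval of order \<open>R\<close>, padded with zeros so
  that it is an element of the group itself.\<close>

definition X :: "nat \<Rightarrow> (nat \<Rightarrow> nat) set" where
  "X R = {x. (\<forall>k<R. x k < m k) \<and> (\<forall>k\<ge>R. x k = 0)}"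

lemma X_subset_space: "X R \<subseteq> vilenkin_space m"
proof
  fix x assume x: "x \<in> X R"
  have "x k < m k" for k
    using x m_pos[of k] by (cases "k < R") (auto simp: X_def)
  then show "x \<in> vilenkin_space m" by (simp add: vilenkin_space_def)
qed

lemma X_0: "X 0 = {\<lambda>_. 0}"
  by (auto simp: X_def)

lemma bij_X_Suc: "bij_betw (\<lambda>(x, j). x(R := j)) (X R \<times> {..<m R}) (X (Suc R))"
proof (rule bij_betw_byWitness[where f' = "\<lambda>x. (x(R := 0), x R)"])
  show "\<forall>a\<in>X R \<times> {..<m R}. (\<lambda>x. (x(R := 0), x R)) ((\<lambda>(x, j). x(R := j)) a) = a"
    by (auto simp: X_def fun_eq_iff)
qed (auto simp: X_def less_Suc_eq)

lemma sum_X_Suc: "(\<Sum>x\<in>X (Suc R). g x) = (\<Sum>x\<in>X R. \<Sum>j<m R. g (x(R := j)))"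
  using sum.reindex_bij_betw[OF bij_X_Suc, of g R, symmetric]
  by (simp add: sum.cartesian_product split_def)

lemma finite_X: "finite (X R)"
proof (induction R)
  case (Suc R) then show ?case using bij_betw_finite[OF bij_X_Suc, of R] by simp
qed (simp add: X_0)

lemma card_X: "card (X R) = M R"
proof (induction R)
  case (Suc R) then show ?case
    using bij_betw_same_card[OF bij_X_Suc, of R] by (simp add: card_cartesian_product M_Suc)
qed (simp add: X_0 M_0)

lemma B_ge2: "B \<ge> 2"
  using m_ge2[of 0] m_le[of 0] by linarith

definition cyl :: "nat \<Rightarrow> nat \<Rightarrow> (nat \<Rightarrow> nat) \<Rightarrow> (nat \<Rightarrow> nat) set" where
  "cyl R n y = {x \<in> X R. \<forall>i<n. x i = y i}"

lemma finite_cyl: "finite (cyl R n y)"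
  by (simp add: cyl_def finite_X)

lemma sum_cyl_split:
  fixes g :: "_ \<Rightarrow> 'a::comm_monoid_add"
  assumes "n < R"
  shows "(\<Sum>x\<in>cyl R n y. g x) = (\<Sum>j<m n. \<Sum>x\<in>cyl R (Suc n) (y(n := j)). g x)"
proof -
  have "cyl R n y = (\<Union>j\<in>{..<m n}. cyl R (Suc n) (y(n := j)))"
    using assms by (auto simp: cyl_def X_def less_Suc_eq)
  then show ?thesis
    by (simp only:) (rule sum.UNION_disjoint, auto simp: finite_cyl, auto simp: cyl_def)
qed

text \<open>Downward induction from a single point at \<open>n = R\<close>: each cylinder is the
  disjoint union of its \<open>m n\<close> children.\<close>

lemma card_cyl:
  assumes "n \<le> R" "\<And>i. i < n \<Longrightarrow> y i < m i"
  shows "card (cyl R n y) * M n = M R"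
  using assms
proof (induction n arbitrary: y rule: inc_induct)
  case base
  have "cyl R R y = {\<lambda>i. if i < R then y i else 0}"
    using base by (auto simp: cyl_def X_def fun_eq_iff)
  then show ?case by simp
next
  case (step n)
  have "card (cyl R n y) = (\<Sum>j<m n. card (cyl R (Suc n) (y(n := j))))"
    using sum_cyl_split[of n R "\<lambda>_. 1::nat" y] step by simp
  then have "card (cyl R n y) * M n * m n = (\<Sum>j<m n. card (cyl R (Suc n) (y(n := j))) * M (Suc n))"
    by (simp add: sum_distrib_right M_Suc mult.assoc)
  also have "\<dots> = (\<Sum>j<m n. M R)"
    using step by (intro sum.cong refl step.IH) (auto simp: less_Suc_eq)
  finally show ?case using m_pos[of n] by simp
qed

text \<open>A center with a coordinate out of range among the first \<open>n\<close> only makes the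
  cylinder empty.\<close>

lemma card_cyl_le: "n \<le> R \<Longrightarrow> card (cyl R n y) * M n \<le> M R"
proof (cases "\<forall>i<n. y i < m i")
  case True
  then show "n \<le> R \<Longrightarrow> ?thesis" using card_cyl[of n R y] by simp
next
  case False
  assume "n \<le> R"
  obtain i where "i < n" "\<not> y i < m i" using False by blast
  have "x \<notin> cyl R n y" for x
  proof
    assume "x \<in> cyl R n y"
    then have "x i = y i" "x i < m i" using \<open>i < n\<close> \<open>n \<le> R\<close> by (auto simp only: cyl_def X_def mem_Collect_eq intro: less_le_trans)
    then show False using \<open>\<not> y i < m i\<close> by simp
  qed
  then have "cyl R n y = {}" by blast
  then show ?thesis by simp
qed

text \<open>Agreement at \<open>s\<close> is permitted as well, and \<open>s = l\<close> means plain
  agreement below \<open>l\<close>. Pairs with none, one or more differing coordinates can thus be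
  treated uniformly.\<close>

definition agree_except :: "nat \<Rightarrow> nat \<Rightarrow> (nat \<Rightarrow> nat) \<Rightarrow> (nat \<Rightarrow> nat) \<Rightarrow> bool" where
  "agree_except s l x y \<longleftrightarrow> (\<forall>i<l. i \<noteq> s \<longrightarrow> x i = y i)"

lemma agree_except_commute: "agree_except s l x y \<longleftrightarrow> agree_except s l y x"
  by (auto simp: agree_except_def)

text \<open>Freeing the coordinate \<open>s\<close> gives at most \<open>B\<close> cylinders of
  order \<open>l\<close>; for \<open>s \<ge> l\<close> there is just one.\<close>

lemma card_agree_except_le:
  assumes "l \<le> R"
  shows "card {x \<in> X R. agree_except s l x y} * M l \<le> B * M R"
proof (cases "s < l")
  case True
  have "{x \<in> X R. agree_except s l x y} = (\<Union>j\<in>{..<m s}. cyl R l (y(s := j)))"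
    using True assms by (auto simp: cyl_def X_def agree_except_def)
  then have "card {x \<in> X R. agree_except s l x y} \<le> (\<Sum>j<m s. card (cyl R l (y(s := j))))"
    by (simp add: card_UN_le)
  then have "card {x \<in> X R. agree_except s l x y} * M l \<le> (\<Sum>j<m s. card (cyl R l (y(s := j)))) * M l"
    by (rule mult_right_mono) simp
  also have "\<dots> \<le> (\<Sum>j<m s. M R)"
    unfolding sum_distrib_right by (intro sum_mono card_cyl_le assms)
  also have "\<dots> \<le> B * M R" using m_le[of s] by simp
  finally show ?thesis .
next
  case False
  then have "{x \<in> X R. agree_except s l x y} = cyl R l y" by (auto simp: cyl_def agree_except_def)
  then have "card {x \<in> X R. agree_except s l x y} * M l \<le> 1 * M R" using card_cyl_le[OF assms] by simp
  also have "\<dots> \<le> B * M R" using B_ge2 by (intro mult_right_mono) auto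
  finally show ?thesis .
qed

section \<open>Rademacher quotients and the pointwise Fejer bound\<close>

lemma norm_rk: "cmod (rk m k x) = 1"
  unfolding rk_def by (subst norm_exp_eq_Re) simp

lemma rk_power: "rk m k x ^ m k = 1"
proof -
  have "rk m k x ^ m k = exp (of_nat (m k) * (2 * pi * \<i> * of_nat (x k) / of_nat (m k)))"
    unfolding rk_def by (rule exp_of_nat_mult[symmetric])
  also have "of_nat (m k) * (2 * pi * \<i> * of_nat (x k) / of_nat (m k)) = 2 * of_int (int (x k)) * pi * \<i>"
    using m_pos[of k] by simp
  also have "exp \<dots> = 1" by (rule exp_integer_2pi) simp
  finally show ?thesis .
qed

text \<open>Equal exponentials have exponents differing by an integer multiple of 2 pi i. Hence
  \<open>x k\<close> and \<open>t k\<close> are congruent modulo \<open>m k\<close>, and both are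
  reduced residues.\<close>

lemma rk_inj:
  assumes "x \<in> vilenkin_space m" "t \<in> vilenkin_space m" "rk m k x = rk m k t"
  shows "x k = t k"
proof -
  have "exp (2 * pi * \<i> * of_nat (x k) / of_nat (m k)) = exp (2 * pi * \<i> * of_nat (t k) / of_nat (m k))"
    using assms(3) by (simp add: rk_def)
  then obtain n :: int where n: "2 * pi * \<i> * of_nat (x k) / of_nat (m k) = 2 * pi * \<i> * of_nat (t k) / of_nat (m k) + (of_int (2 * n) * pi) * \<i>"
    unfolding exp_eq by blast
  have "Im (2 * pi * \<i> * of_nat (x k) / of_nat (m k)) = Im (2 * pi * \<i> * of_nat (t k) / of_nat (m k) + (of_int (2 * n) * pi) * \<i>)"
    by (simp only: n)
  then have "2 * pi * (x k / m k) = 2 * pi * (t k / m k + n)"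
    by (simp add: algebra_simps)
  then have "real (x k) / m k = t k / m k + n"
    by (simp only: mult_cancel_left) simp
  then have "real (x k) = t k + n * m k" using m_pos[of k] by (simp add: field_simps)
  then have "real_of_int (int (x k)) = real_of_int (int (t k) + n * int (m k))" by simp
  then have *: "int (x k) = int (t k) + n * int (m k)" by (simp only: of_int_eq_iff)
  have "x k < m k" "t k < m k" using assms by (auto simp: vilenkin_space_def)
  then have "int (x k) = (int (t k) + n * int (m k)) mod int (m k)" "int (t k) mod int (m k) = int (t k)"
    unfolding *[symmetric] by simp_all
  then have "int (x k) = int (t k)" by (simp only: mod_mult_self1)
  then show ?thesis by simp
qed

text \<open>The value of r_k at the group difference x - t, written without the group
  operation.\<close>

definition rk_quot :: "(nat \<Rightarrow> nat) \<Rightarrow> (nat \<Rightarrow> nat) \<Rightarrow> nat \<Rightarrow> complex" where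
  "rk_quot x t k = rk m k x * cnj (rk m k t)"

lemma norm_rk_quot: "cmod (rk_quot x t k) = 1"
  by (simp add: rk_quot_def norm_mult norm_rk)

lemma rk_quot_power: "rk_quot x t k ^ m k = 1"
  by (simp add: rk_quot_def power_mult_distrib rk_power flip: complex_cnj_power)

lemma rk_quot_neq_1:
  assumes "x \<in> vilenkin_space m" "t \<in> vilenkin_space m" "x k \<noteq> t k"
  shows "rk_quot x t k \<noteq> 1"
proof
  assume "rk_quot x t k = 1"
  then have "rk_quot x t k * rk m k t = rk m k t" by simp
  then have "rk m k x * (rk m k t * cnj (rk m k t)) = rk m k t" by (simp add: rk_quot_def ac_simps)
  then have "rk m k x = rk m k t" by (simp add: norm_rk flip: complex_norm_square)
  then show False using rk_inj assms by blast
qed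

lemma chi_rk_quot: "chi (rk_quot x t) i = psi m i x * cnj (psi m i t)"
  by (simp add: chi_def rk_quot_def psi_def power_mult_distrib prod.distrib)

text \<open>If \<open>x\<close> and \<open>t\<close> first differ at \<open>s\<close> and next at \<open>l\<close>, the Fejer kernel (times its index) is of order
  \<open>M s * M l\<close>. Summing over all admissible pairs avoids naming these two positions.\<close>
definition kernel_bd :: "nat \<Rightarrow> (nat \<Rightarrow> nat) \<Rightarrow> (nat \<Rightarrow> nat) \<Rightarrow> real" where
  "kernel_bd r x t = (\<Sum>l\<le>r. \<Sum>s\<le>l. real (M s) * real (M l) * of_bool (agree_except s l x t))"

lemma kernel_bd_ge:
  assumes "l \<le> r" "s \<le> l" "agree_except s l x t"
  shows "real (M s) * real (M l) \<le> kernel_bd r x t"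
proof -
  have "real (M s) * real (M l) * of_bool (agree_except s l x t) \<le> (\<Sum>s\<le>l. real (M s) * real (M l) * of_bool (agree_except s l x t))"
    by (rule member_le_sum[of s]) (use assms in auto)
  also have "\<dots> \<le> kernel_bd r x t" unfolding kernel_bd_def
    by (rule member_le_sum[of l]) (use assms in \<open>auto intro: sum_nonneg\<close>)
  finally show ?thesis using assms by simp
qed

lemma kernel_bd_nonneg: "kernel_bd r x t \<ge> 0"
  unfolding kernel_bd_def by (intro sum_nonneg) auto

text \<open>Three cases by the number of differing coordinates below \<open>r\<close>. With none,
  \<open>s = l = r\<close> and the trivial quadratic bound are used; with one, \<open>l = r\<close>;
  otherwise \<open>s\<close> and \<open>l\<close> are the first two. The square of \<open>B\<close>
  pays for replacing \<open>M (Suc s)\<close> and \<open>M (Suc l)\<close> by \<open>M s\<close> and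
  \<open>M l\<close>.\<close>

lemma fejer_kernel_bound:
  assumes xt: "x \<in> vilenkin_space m" "t \<in> vilenkin_space m" and j: "j \<le> Suc (M r)"
  shows "cmod (\<Sum>k<j. dirichlet (rk_quot x t) k) \<le> 4 * real B ^ 2 * kernel_bd r x t"
proof (cases "\<forall>i<r. x i = t i")
  case True
  have "cmod (\<Sum>k<j. dirichlet (rk_quot x t) k) \<le> real j * real j" by (rule norm_sum_dirichlet_le) (rule norm_rk_quot)
  also have "\<dots> \<le> (2 * real (M r)) * (2 * real (M r))"
    using j M_pos[of r] by (intro mult_mono) linarith+
  also have "\<dots> = 4 * 1 * (real (M r) * real (M r))" by simp
  also have "\<dots> \<le> 4 * real B ^ 2 * kernel_bd r x t"
    using True B_ge2 by (intro mult_mono kernel_bd_ge) (auto simp: agree_except_def)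
  finally show ?thesis .
next
  case False
  define s where "s = (LEAST i. x i \<noteq> t i)"
  have s: "x s \<noteq> t s" "\<And>i. i < s \<Longrightarrow> x i = t i" "s < r"
  proof -
    obtain i where i: "i < r" "x i \<noteq> t i" using False by blast
    show "x s \<noteq> t s" unfolding s_def by (rule LeastI[of "\<lambda>i. x i \<noteq> t i", OF i(2)])
    show "s < r" using i Least_le[of "\<lambda>i. x i \<noteq> t i", OF i(2)] by (simp add: s_def)
    show "x i = t i" if "i < s" for i using not_less_Least[OF that[unfolded s_def]] by simp
  qed
  have Ms: "real (M (Suc i)) \<le> real B * real (M i)" for i
    using M_Suc_le[of i] by (metis of_nat_le_iff of_nat_mult)
  show ?thesis
  proof (cases "\<forall>i<r. i \<noteq> s \<longrightarrow> x i = t i")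
    case True
    have "cmod (\<Sum>k<j. dirichlet (rk_quot x t) k) \<le> 3 * real (M (Suc s)) * real (M r)"
      by (rule fejer_bound_one) (use xt j s in \<open>auto simp: norm_rk_quot rk_quot_power rk_quot_neq_1\<close>)
    also have "\<dots> \<le> 3 * (real B * real (M s)) * real (M r)"
      by (intro mult_mono Ms) auto
    also have "\<dots> = 3 * real B * (real (M s) * real (M r))" by simp
    also have "\<dots> \<le> 4 * real B ^ 2 * kernel_bd r x t"
      using True B_ge2 s by (intro mult_mono kernel_bd_ge) (auto simp: agree_except_def power2_eq_square)
    finally show ?thesis .
  next
    case False
    define l where "l = (LEAST i. i \<noteq> s \<and> x i \<noteq> t i)"
    have l: "l \<noteq> s \<and> x l \<noteq> t l" "\<And>i. i < l \<Longrightarrow> i \<noteq> s \<Longrightarrow> x i = t i" "l < r"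
    proof -
      obtain i where i: "i < r" "i \<noteq> s \<and> x i \<noteq> t i" using False by blast
      show "l \<noteq> s \<and> x l \<noteq> t l" unfolding l_def by (rule LeastI[of "\<lambda>i. i \<noteq> s \<and> x i \<noteq> t i", OF i(2)])
      show "l < r" using i Least_le[of "\<lambda>i. i \<noteq> s \<and> x i \<noteq> t i", OF i(2)] by (simp add: l_def)
      show "x i = t i" if "i < l" "i \<noteq> s" for i using not_less_Least[OF that(1)[unfolded l_def]] that(2) by simp
    qed
    then have sl: "s < l" using s(2)[of l] by force
    have "cmod (\<Sum>k<j. dirichlet (rk_quot x t) k) \<le> 2 * real (M (Suc s)) * real (M (Suc l))"
      by (rule fejer_bound_two) (use xt l s sl in \<open>auto simp: norm_rk_quot rk_quot_power rk_quot_neq_1\<close>)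
    also have "\<dots> \<le> 2 * (real B * real (M s)) * (real B * real (M l))"
      by (intro mult_mono Ms) auto
    also have "\<dots> = 2 * real B ^ 2 * (real (M s) * real (M l))" by (simp add: power2_eq_square)
    also have "\<dots> \<le> 4 * real B ^ 2 * kernel_bd r x t"
      using l sl by (intro mult_mono kernel_bd_ge) (auto simp: agree_except_def)
    finally show ?thesis .
  qed
qed

end

section \<open>Noerlund kernels under the growth condition on the weights\<close>

locale norlund = vilenkin +
  fixes q :: "nat \<Rightarrow> real" and C :: real
  assumes q_mono: "mono q" and q_nonneg: "q k \<ge> 0" and q0: "q 0 > 0"
    and q_ratio: "n \<ge> 1 \<Longrightarrow> q (n - 1) / Qsum q n \<le> C / real n"
begin

lemma Qsum_pos: "n \<ge> 1 \<Longrightarrow> Qsum q n > 0"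
  unfolding Qsum_def by (rule sum_pos2[of _ 0]) (auto simp: q_nonneg q0)

lemma C_pos: "C > 0"
  using q_ratio[of 1] q0 by (simp add: Qsum_def)

definition norlund_kernel :: "nat \<Rightarrow> (nat \<Rightarrow> nat) \<Rightarrow> (nat \<Rightarrow> nat) \<Rightarrow> complex" where
  "norlund_kernel k x t = (\<Sum>j=1..k. of_real (q (k - j)) * dirichlet (rk_quot x t) j) / of_real (Qsum q k)"

definition C1 :: real where "C1 = 4 * real B ^ 2 * C"

lemma C1_pos: "C1 > 0"
  using C_pos B_ge2 by (simp add: C1_def)

text \<open>The weights \<open>q (k - j)\<close> decrease in \<open>j\<close>, so summation by parts
  leaves the largest one, \<open>q (k - 1)\<close>, whose quotient by \<open>Qsum q k\<close> is at
  most \<open>C / real k\<close>.\<close>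

lemma norlund_kernel_bound:
  assumes "x \<in> vilenkin_space m" "t \<in> vilenkin_space m" "k \<ge> 1" "k \<le> M r"
  shows "cmod (norlund_kernel k x t) \<le> C1 / real k * kernel_bd r x t"
proof -
  have 1: "(\<Sum>j=1..k. of_real (q (k - j)) * dirichlet (rk_quot x t) j) = (\<Sum>i<k. of_real (q (k - Suc i)) * dirichlet (rk_quot x t) (Suc i))"
    by (rule sum.reindex_bij_witness[of _ Suc "\<lambda>i. i - 1"]) auto
  have "cmod (\<Sum>i<k. of_real (q (k - Suc i)) * dirichlet (rk_quot x t) (Suc i)) \<le> q (k - Suc 0) * (4 * real B ^ 2 * kernel_bd r x t)"
  proof (rule abel_bound)
    show "antimono (\<lambda>i. q (k - Suc i))"
      by (rule antimonoI, rule monoD[OF q_mono]) simp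
    fix j assume j: "j \<le> k"
    \<comment> \<open>The Dirichlet kernel of index 0 is zero, so the index shift costs nothing but
      one more term.\<close>
    have "(\<Sum>i<j. dirichlet (rk_quot x t) (Suc i)) = (\<Sum>i<Suc j. dirichlet (rk_quot x t) i)"
      unfolding sum.lessThan_Suc_shift by (simp add: dirichlet_def)
    then show "cmod (\<Sum>i<j. dirichlet (rk_quot x t) (Suc i)) \<le> 4 * real B ^ 2 * kernel_bd r x t"
      using fejer_kernel_bound[OF assms(1,2), of "Suc j" r] j assms(4) by simp
  qed (rule q_nonneg)
  then have "cmod (norlund_kernel k x t) \<le> q (k - 1) * (4 * real B ^ 2 * kernel_bd r x t) / Qsum q k"
    using Qsum_pos[OF assms(3)] unfolding norlund_kernel_def 1 by (simp add: norm_divide divide_right_mono)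
  also have "\<dots> = q (k - 1) / Qsum q k * (4 * real B ^ 2 * kernel_bd r x t)" by simp
  also have "\<dots> \<le> C / real k * (4 * real B ^ 2 * kernel_bd r x t)"
    by (intro mult_right_mono q_ratio assms mult_nonneg_nonneg kernel_bd_nonneg) auto
  finally show ?thesis by (simp add: C1_def ac_simps)
qed

end

section \<open>Estimates for atoms\<close>

lemma sqrt_sum_le:
  assumes "finite I" "\<And>i. i \<in> I \<Longrightarrow> f i \<ge> (0::real)"
  shows "sqrt (\<Sum>i\<in>I. f i) \<le> (\<Sum>i\<in>I. sqrt (f i))"
  using assms
proof (induction I rule: finite_induct)
  case (insert j I)
  have "sqrt (f j + (\<Sum>i\<in>I. f i)) \<le> sqrt (f j) + sqrt (\<Sum>i\<in>I. f i)"
    using insert by (intro sqrt_add_le_add_sqrt sum_nonneg) auto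
  also have "\<dots> \<le> sqrt (f j) + (\<Sum>i\<in>I. sqrt (f i))" using insert by simp
  finally show ?case using insert by simp
qed simp

text \<open>The inequality ln t \<le> t - 1 at t = n / (n + 1) bounds each new term by the increment
  of the logarithm.\<close>

lemma sum_inverse_le_ln:
  assumes "n \<ge> (1::nat)"
  shows "(\<Sum>k=1..n. 1 / real k) \<le> 1 + ln (real n)"
  using assms
proof (induction n rule: dec_induct)
  case (step n)
  have "ln (real n / real (Suc n)) \<le> real n / real (Suc n) - 1"
    using step by (intro ln_le_minus_one) auto
  also have "\<dots> = - (1 / real (Suc n))" by (simp add: field_simps)
  also have "ln (real n / real (Suc n)) = ln (real n) - ln (real (Suc n))"
    using step by (subst ln_div) auto
  finally have "1 / real (Suc n) \<le> ln (real (Suc n)) - ln (real n)" by simp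
  then show ?case using step by simp
qed simp

text \<open>Comparison with the telescoping differences of 2 / sqrt k: with a and b the roots of n
  and n + 1, the difference is 2 / (a b (a + b)), which is at least 1 / b^3.\<close>

lemma sum_three_halves_le:
  assumes "M \<ge> (1::nat)"
  shows "(\<Sum>k=Suc M..n. 1 / (real k * sqrt (real k))) \<le> 2 / sqrt (real M)"
proof -
  have "(\<Sum>k=Suc M..n. 1 / (real k * sqrt (real k))) \<le> 2 / sqrt (real M) - 2 / sqrt (real n)" if "M \<le> n"
    using that
  proof (induction n rule: dec_induct)
    case (step n)
    define a b where "a = sqrt (real n)" and "b = sqrt (real (Suc n))"
    have ab: "0 < a" "a \<le> b" "b * b = a * a + 1" "real (Suc n) = b * b"
      using step assms by (auto simp: a_def b_def)
    have "a * (a + b) \<le> b * (b + b)" using ab by (intro mult_mono) auto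
    then have "a * (a + b) \<le> 2 * (b * b)" by (simp add: algebra_simps)
    have "1 / (b * b * b) \<le> 2 / a - 2 / b"
    proof -
      have "2 / a - 2 / b = 2 * (b - a) / (a * b)" using ab by (simp add: field_simps)
      also have "b - a = 1 / (a + b)" using ab by (simp add: field_simps)
      finally have e: "2 / a - 2 / b = 2 / (a * b * (a + b))" by simp
      have "a * b * (a + b) \<le> 2 * (b * b * b)"
        using mult_left_mono[OF \<open>a * (a + b) \<le> 2 * (b * b)\<close>, of b] ab by (simp add: algebra_simps)
      then show ?thesis unfolding e using ab by (simp add: divide_simps)
    qed
    then have "1 / (real (Suc n) * b) \<le> 2 / a - 2 / b" by (simp only: ab(4))
    then show ?case using step by (simp add: a_def b_def)
  qed simp
  moreover have "(2 / sqrt (real n)) \<ge> 0" by simp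
  ultimately show ?thesis 
    by (cases "M \<le> n") (linarith, simp)
qed

section \<open>Geometric growth of \<open>M\<close> and integrals of the kernel bound\<close>

context vilenkin
begin

lemma sum_M_le: "(\<Sum>s\<le>l. real (M s)) \<le> 2 * real (M l)"
proof (induction l)
  case (Suc l)
  have "2 * real (M l) \<le> real (M (Suc l))" using M_Suc_ge[of l] by linarith
  then show ?case using Suc by simp
qed (simp add: M_0)

lemma sum_sqrt_M_le: "(\<Sum>s\<le>l. sqrt (real (M s))) \<le> 4 * sqrt (real (M l))"
proof (induction l)
  case (Suc l)
  \<comment> \<open>Since \<open>M\<close> at least doubles, its roots grow by more than 4/3, a
    rational bound below sqrt 2; the geometric series with ratio 3/4 gives the constant 4.\<close>
  have "(4 / 3) ^ 2 * real (M l) \<le> real (M (Suc l))"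
    using M_Suc_ge[of l] M_pos[of l] by (simp add: power2_eq_square)
  then have "sqrt ((4 / 3) ^ 2 * real (M l)) \<le> sqrt (real (M (Suc l)))" by (rule real_sqrt_le_mono)
  then have "4 / 3 * sqrt (real (M l)) \<le> sqrt (real (M (Suc l)))" by (simp add: real_sqrt_mult)
  then show ?case using Suc by simp
qed (simp add: M_0)

text \<open>The first scale that resolves the index \<open>k\<close>; \<open>M (level k)\<close> is
  comparable to \<open>k\<close> up to the factor \<open>B\<close>.\<close>

definition level :: "nat \<Rightarrow> nat" where "level k = (LEAST r. k \<le> M r)"

lemma le_M_level: "k \<le> M (level k)"
  unfolding level_def by (rule LeastI[of _ k]) (use less_M[of k] in simp)

lemma level_le: "k \<le> M R \<Longrightarrow> level k \<le> R"
  unfolding level_def by (rule Least_le)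

lemma level_Suc_less:
  assumes "level k = Suc r" shows "M r < k"
proof (rule ccontr)
  assume "\<not> M r < k"
  then have "level k \<le> r" by (intro level_le) simp
  then show False using assms by simp
qed

lemma M_level_le: "k \<ge> 1 \<Longrightarrow> real (M (level k)) \<le> real B * real k"
proof (cases "level k")
  case 0
  assume "k \<ge> 1"
  then have "1 * 1 \<le> real B * real k" using B_ge2 by (intro mult_mono) auto
  then show ?thesis using 0 by (simp add: M_0)
next
  case (Suc r)
  have "M (Suc r) \<le> B * M r" by (rule M_Suc_le)
  also have "\<dots> \<le> B * k" using level_Suc_less[OF Suc] by simp
  finally show ?thesis using Suc by (metis of_nat_le_iff of_nat_mult)
qed

text \<open>The scale just below the level is smaller than \<open>k\<close>, hence
  \<open>2 ^ level k \<le> 2 * k\<close>. Both the factor 2 and the added 1 are absorbed by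
  \<open>ln (real n)\<close>, which is at least ln 2 and so at least 2/3.\<close>

lemma level_le_ln:
  assumes "k \<ge> 1" "k \<le> n" "n \<ge> 2"
  shows "real (level k) + 1 \<le> 5 * ln (real n)"
proof -
  have "2 ^ level k \<le> 2 * k"
  proof (cases "level k")
    case (Suc r)
    then show ?thesis using M_ge_power[of r] level_Suc_less[OF Suc] by simp
  qed (use assms in simp)
  then have "real (2 ^ level k) \<le> real (2 * n)" using assms by (intro of_nat_mono) simp
  then have "ln (2 ^ level k) \<le> ln (2 * real n)" by (subst ln_le_cancel_iff) (use assms in auto)
  also have "\<dots> = ln 2 + ln (real n)" using assms by (subst ln_mult) auto
  finally have 1: "real (level k) * ln 2 \<le> ln 2 + ln (real n)" by (simp add: ln_realpow)
  have 2: "ln 2 \<le> ln (real n)" using assms by (subst ln_le_cancel_iff) auto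
  have 3: "real (level k) * (2 / 3) \<le> real (level k) * ln 2"
    by (intro mult_left_mono) (use ln2_ge_two_thirds in auto)
  show ?thesis using 1 2 3 ln2_ge_two_thirds by simp
qed

text \<open>The set belonging to the pair \<open>s\<close>, \<open>l\<close> has proportion at most
  \<open>B / M l\<close>, which cancels the factor \<open>M l\<close>. The remaining sums over
  \<open>s\<close> and then over \<open>l\<close> are geometric, each costing a factor 2.\<close>

lemma sum_kernel_bd_le:
  assumes "r \<le> R"
  shows "(\<Sum>t\<in>X R. kernel_bd r x t) \<le> 4 * real B * real (M r) * real (M R)"
proof -
  have c: "real (M s) * (real (M l) * real (card {t \<in> X R. agree_except s l x t})) \<le> real (M s) * (real B * real (M R))"
    if "l \<le> r" for s l
  proof (rule mult_left_mono)
    have "M l * card {t \<in> X R. agree_except s l x t} \<le> B * M R"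
      using card_agree_except_le[of l R s x] that assms by (simp add: agree_except_commute mult.commute)
    then show "real (M l) * real (card {t \<in> X R. agree_except s l x t}) \<le> real B * real (M R)"
      by (metis of_nat_le_iff of_nat_mult)
  qed simp
  have "(\<Sum>t\<in>X R. kernel_bd r x t) = (\<Sum>l\<le>r. \<Sum>t\<in>X R. \<Sum>s\<le>l. real (M s) * real (M l) * of_bool (agree_except s l x t))"
    unfolding kernel_bd_def by (rule sum.swap)
  also have "\<dots> = (\<Sum>l\<le>r. \<Sum>s\<le>l. \<Sum>t\<in>X R. real (M s) * real (M l) * of_bool (agree_except s l x t))"
    by (intro sum.cong refl sum.swap)
  also have "\<dots> = (\<Sum>l\<le>r. \<Sum>s\<le>l. real (M s) * (real (M l) * real (card {t \<in> X R. agree_except s l x t})))"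
    by (intro sum.cong refl) (simp add: finite_X Int_def mult.assoc flip: sum_distrib_left)
  also have "\<dots> \<le> (\<Sum>l\<le>r. \<Sum>s\<le>l. real (M s) * (real B * real (M R)))"
    by (intro sum_mono c) auto
  also have "\<dots> = (\<Sum>l\<le>r. (\<Sum>s\<le>l. real (M s)) * (real B * real (M R)))"
    by (simp add: sum_distrib_right)
  also have "\<dots> \<le> (\<Sum>l\<le>r. 2 * real (M l) * (real B * real (M R)))"
    by (intro sum_mono mult_right_mono sum_M_le) auto
  also have "\<dots> = 2 * (\<Sum>l\<le>r. real (M l)) * (real B * real (M R))"
    by (simp add: sum_distrib_right sum_distrib_left)
  also have "\<dots> \<le> 2 * (2 * real (M r)) * (real B * real (M R))"
    by (intro mult_right_mono mult_left_mono sum_M_le) auto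
  finally show ?thesis by (simp add: ac_simps)
qed

end

section \<open>The finite Noerlund operator and its uniform boundedness\<close>

context norlund
begin

text \<open>The Noerlund mean of a function of the first \<open>R\<close> coordinates, with the Haar
  integral replaced by the average over \<open>X R\<close>.\<close>

definition T :: "nat \<Rightarrow> ((nat \<Rightarrow> nat) \<Rightarrow> complex) \<Rightarrow> nat \<Rightarrow> (nat \<Rightarrow> nat) \<Rightarrow> complex" where
  "T R g k x = (\<Sum>t\<in>X R. g t * norlund_kernel k x t) / of_nat (M R)"

definition C2 :: real where "C2 = 4 * C1 * real B ^ 2"

lemma C2_pos: "C2 > 0"
  using C1_pos B_ge2 by (simp add: C2_def)

text \<open>The set \<open>S\<close> carries the support of \<open>g\<close>; it is all of
  \<open>X R\<close> for the uniform bound and a cylinder for atoms.\<close>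

lemma norm_T_le_kernel_bd:
  assumes "x \<in> X R" "k \<ge> 1" "k \<le> M r" "\<And>t. t \<in> S \<Longrightarrow> cmod (g t) \<le> A" "A \<ge> 0"
    "S \<subseteq> X R" "\<And>t. t \<in> X R \<Longrightarrow> t \<notin> S \<Longrightarrow> g t = 0"
  shows "cmod (T R g k x) \<le> A * C1 / real k * (\<Sum>t\<in>S. kernel_bd r x t) / real (M R)"
proof -
  have "cmod (\<Sum>t\<in>S. g t * norlund_kernel k x t) \<le> (\<Sum>t\<in>S. A * (C1 / real k * kernel_bd r x t))"
  proof (rule sum_norm_le)
    fix t assume t: "t \<in> S"
    then have "cmod (norlund_kernel k x t) \<le> C1 / real k * kernel_bd r x t"
      using assms X_subset_space by (intro norlund_kernel_bound) blast+
    then show "cmod (g t * norlund_kernel k x t) \<le> A * (C1 / real k * kernel_bd r x t)"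
      unfolding norm_mult using assms t by (intro mult_mono) auto
  qed
  also have "\<dots> = A * C1 / real k * (\<Sum>t\<in>S. kernel_bd r x t)"
    by (simp add: sum_distrib_left mult.assoc)
  also have "(\<Sum>t\<in>S. g t * norlund_kernel k x t) = (\<Sum>t\<in>X R. g t * norlund_kernel k x t)"
    by (rule sum.mono_neutral_left) (use assms finite_X in auto)
  finally show ?thesis
    unfolding T_def norm_divide norm_of_nat by (rule divide_right_mono) simp
qed

text \<open>At the scale \<open>level k\<close> the kernel bound has integral of order
  \<open>k\<close>, which the factor \<open>1 / real k\<close> balances.\<close>

lemma norm_T_le:
  assumes "x \<in> X R" "k \<ge> 1" "k \<le> M R" "\<And>t. t \<in> X R \<Longrightarrow> cmod (g t) \<le> A" "A \<ge> 0"
  shows "cmod (T R g k x) \<le> C2 * A"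
proof -
  have "cmod (T R g k x) \<le> A * C1 / real k * (\<Sum>t\<in>X R. kernel_bd (level k) x t) / real (M R)"
    by (rule norm_T_le_kernel_bd) (use assms le_M_level in auto)
  also have "\<dots> \<le> A * C1 / real k * (4 * real B * (real B * real k) * real (M R)) / real (M R)"
  proof (intro divide_right_mono mult_left_mono)
    have "(\<Sum>t\<in>X R. kernel_bd (level k) x t) \<le> 4 * real B * real (M (level k)) * real (M R)"
      using assms by (intro sum_kernel_bd_le level_le)
    also have "\<dots> \<le> 4 * real B * (real B * real k) * real (M R)"
      using M_level_le assms by (intro mult_right_mono mult_left_mono) auto
    finally show "(\<Sum>t\<in>X R. kernel_bd (level k) x t) \<le> 4 * real B * (real B * real k) * real (M R)" .
  qed (use assms C1_pos in auto)
  also have "\<dots> = C2 * A" using assms M_pos[of R] by (simp add: C2_def power2_eq_square)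
  finally show ?thesis .
qed

text \<open>Only characters of index below \<open>M N\<close> occur, and these depend on the first
  \<open>N\<close> coordinates alone.\<close>

lemma norlund_kernel_cong:
  assumes "k \<le> M N" "\<And>i. i < N \<Longrightarrow> t i = y i"
  shows "norlund_kernel k x t = norlund_kernel k x y"
proof -
  have "dirichlet (rk_quot x t) j = dirichlet (rk_quot x y) j" if "j \<le> k" for j
    unfolding dirichlet_def
  proof (rule sum.cong[OF refl])
    fix i assume "i \<in> {..<j}"
    then show "chi (rk_quot x t) i = chi (rk_quot x y) i"
      using that assms by (intro chi_cong[of i N]) (auto simp: rk_quot_def rk_def)
  qed
  then show ?thesis by (simp add: norlund_kernel_def)
qed

text \<open>Without its factor \<open>1 / ln n\<close>, the quantity to be estimated, for a function \<open>g\<close> of the first \<open>R\<close> coordinates.\<close>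
definition Phi :: "nat \<Rightarrow> nat \<Rightarrow> ((nat \<Rightarrow> nat) \<Rightarrow> complex) \<Rightarrow> real" where
  "Phi n R g = (\<Sum>k=1..n. (\<Sum>x\<in>X R. sqrt (cmod (T R g k x))) / real (M R) / real k)"

lemma T_sum: "T R (\<lambda>t. \<Sum>i\<in>I. g i t) k x = (\<Sum>i\<in>I. T R (g i) k x)"
  unfolding T_def sum_distrib_right by (subst sum.swap) (simp add: sum_divide_distrib)

lemma Phi_sum_le:
  assumes "finite I"
  shows "Phi n R (\<lambda>t. \<Sum>i\<in>I. g i t) \<le> (\<Sum>i\<in>I. Phi n R (g i))"
proof -
  have 1: "sqrt (cmod (\<Sum>i\<in>I. T R (g i) k x)) \<le> (\<Sum>i\<in>I. sqrt (cmod (T R (g i) k x)))" for k x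
    by (rule order.trans[OF real_sqrt_le_mono[OF norm_sum] sqrt_sum_le]) (use assms in auto)
  have "Phi n R (\<lambda>t. \<Sum>i\<in>I. g i t) \<le> (\<Sum>k=1..n. (\<Sum>x\<in>X R. \<Sum>i\<in>I. sqrt (cmod (T R (g i) k x))) / real (M R) / real k)"
    unfolding Phi_def T_sum by (intro sum_mono divide_right_mono 1) auto
  also have "\<dots> = (\<Sum>i\<in>I. Phi n R (g i))"
    unfolding Phi_def by (subst (2) sum.swap, subst sum.swap) (simp add: sum_divide_distrib)
  finally show ?thesis .
qed

lemma sum_inverse_le_3ln: "n \<ge> (2::nat) \<Longrightarrow> (\<Sum>k=1..n. 1 / real k) \<le> 3 * ln (real n)"
proof -
  assume n: "n \<ge> 2"
  have "ln 2 \<le> ln (real n)" using n by (subst ln_le_cancel_iff) auto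
  then show ?thesis using sum_inverse_le_ln[of n] n ln2_ge_two_thirds by linarith
qed

lemma Phi_le_sup:
  assumes "n \<ge> 2" "n \<le> M R" "\<And>t. t \<in> X R \<Longrightarrow> cmod (g t) \<le> A" "A \<ge> 0"
  shows "Phi n R g \<le> 3 * sqrt C2 * sqrt A * ln (real n)"
proof -
  have "Phi n R g \<le> (\<Sum>k=1..n. (\<Sum>x\<in>X R. sqrt (C2 * A)) / real (M R) / real k)"
    unfolding Phi_def using assms
    by (intro sum_mono divide_right_mono real_sqrt_le_mono norm_T_le) auto
  also have "\<dots> = sqrt (C2 * A) * (\<Sum>k=1..n. 1 / real k)"
    using M_pos[of R] by (simp add: card_X sum_distrib_left)
  also have "\<dots> \<le> sqrt (C2 * A) * (3 * ln (real n))"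
    using assms C2_pos by (intro mult_left_mono sum_inverse_le_3ln) auto
  finally show ?thesis by (simp add: real_sqrt_mult ac_simps)
qed

section \<open>A single atom near its interval and away from it\<close>

context
  fixes a :: "(nat \<Rightarrow> nat) \<Rightarrow> complex" and R N :: nat and y :: "nat \<Rightarrow> nat" and A :: real
  assumes NR: "N \<le> R" and supp: "\<And>t. t \<in> X R \<Longrightarrow> t \<notin> cyl R N y \<Longrightarrow> a t = 0"
    and bdd: "\<And>t. t \<in> X R \<Longrightarrow> cmod (a t) \<le> A" and A: "A \<ge> 0"
    and mean: "(\<Sum>t\<in>cyl R N y. a t) = 0"
begin

text \<open>The kernel is constant in \<open>t\<close> on the supporting interval, so the vanishing
  mean of the atom annihilates it.\<close>

lemma T_atom_eq_0:
  assumes "k \<le> M N"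
  shows "T R a k x = 0"
proof -
  have "(\<Sum>t\<in>X R. a t * norlund_kernel k x t) = (\<Sum>t\<in>cyl R N y. a t * norlund_kernel k x t)"
    by (rule sum.mono_neutral_right) (auto simp: finite_X supp cyl_def)
  also have "\<dots> = (\<Sum>t\<in>cyl R N y. a t * norlund_kernel k x y)"
    by (intro sum.cong refl arg_cong2[where f = "(*)"] norlund_kernel_cong[OF assms]) (simp add: cyl_def)
  also have "\<dots> = 0" by (simp add: mean flip: sum_distrib_right)
  finally show ?thesis by (simp add: T_def)
qed

text \<open>For \<open>l \<le> N\<close> every \<open>t\<close> in the interval equals
  \<open>y\<close> below \<open>l\<close>, so the condition concerns only \<open>x\<close> and
  \<open>y\<close>. For \<open>l > N\<close> the coordinates of \<open>t\<close> below
  \<open>l\<close> are prescribed, by \<open>y\<close> below \<open>N\<close> and by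
  \<open>x\<close> afterwards. The minimum and maximum of \<open>l\<close> and \<open>N\<close>
  express both cases at once.\<close>

lemma card_cyl_agree_except_le:
  assumes x: "x \<in> X R" "x \<notin> cyl R N y" and "l \<le> R" and sl: "s \<le> l"
  shows "real (card {t \<in> cyl R N y. agree_except s l x t})
    \<le> real (M R) / real (M (max l N)) * of_bool (s \<le> min l N \<and> agree_except s (min l N) x y)"
proof -
  have ccyl: "real (card (cyl R n z)) \<le> real (M R) / real (M n)" if "n \<le> R" for n z
  proof -
    have "real (card (cyl R n z) * M n) \<le> real (M R)" by (intro of_nat_mono card_cyl_le that)
    then show ?thesis using M_pos[of n] by (simp add: field_simps)
  qed
  have x': "\<exists>i<N. x i \<noteq> y i" using x by (auto simp: cyl_def)
  show ?thesis
  proof (cases "l \<le> N")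
    case True
    show ?thesis
    proof (cases "agree_except s l x y")
      case a: True
      have "card {t \<in> cyl R N y. agree_except s l x t} \<le> card (cyl R N y)"
        by (intro card_mono finite_cyl) auto
      then show ?thesis using a True sl ccyl[OF NR, of y] by (simp add: max_absorb2 min_absorb1)
    next
      case False
      have "{t \<in> cyl R N y. agree_except s l x t} = {}"
        using False True by (auto simp: cyl_def agree_except_def)
      then show ?thesis by (simp only: card.empty) simp
    qed
  next
    case False
    then have Nl: "N < l" by simp
    show ?thesis
    proof (cases "s < N \<and> agree_except s N x y")
      case True
      have "{t \<in> cyl R N y. agree_except s l x t} \<subseteq> cyl R l (\<lambda>i. if i < N then y i else x i)"
        using True by (auto simp: cyl_def agree_except_def)
      then have "card {t \<in> cyl R N y. agree_except s l x t} \<le> card (cyl R l (\<lambda>i. if i < N then y i else x i))"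
        by (intro card_mono finite_cyl)
      then show ?thesis using True Nl ccyl[OF \<open>l \<le> R\<close>, of "\<lambda>i. if i < N then y i else x i"]
        by (simp add: max_absorb1 min_absorb2)
    next
      case False
      have "t \<notin> {t \<in> cyl R N y. agree_except s l x t}" for t
      proof
        assume t: "t \<in> {t \<in> cyl R N y. agree_except s l x t}"
        then have "agree_except s N x y" using Nl by (simp add: cyl_def agree_except_def)
        moreover have "s < N"
        proof (rule ccontr)
          assume "\<not> s < N"
          \<comment> \<open>An exceptional position at or beyond \<open>N\<close> would force
            \<open>x\<close> into the interval.\<close>
          then have "x i = y i" if "i < N" for i using that t Nl by (simp add: cyl_def agree_except_def)
          then show False using x' by blast
        qed
        ultimately show False using False by simp
      qed
      then have "{t \<in> cyl R N y. agree_except s l x t} = {}" by blast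
      then show ?thesis by (simp only: card.empty) simp
    qed
  qed
qed

lemma T_atom_far:
  assumes x: "x \<in> X R" "x \<notin> cyl R N y" and k: "k \<ge> 1" "k \<le> M R"
  shows "cmod (T R a k x) \<le> (\<Sum>l\<le>level k. \<Sum>s\<le>min l N.
    A * C1 / real k * (real (M s) * real (M l) / real (M (max l N))) * of_bool (agree_except s (min l N) x y))"
proof -
  have "(\<Sum>t\<in>cyl R N y. kernel_bd (level k) x t)
      = (\<Sum>l\<le>level k. \<Sum>t\<in>cyl R N y. \<Sum>s\<le>l. real (M s) * real (M l) * of_bool (agree_except s l x t))"
    unfolding kernel_bd_def by (rule sum.swap)
  also have "\<dots> = (\<Sum>l\<le>level k. \<Sum>s\<le>l. \<Sum>t\<in>cyl R N y. real (M s) * real (M l) * of_bool (agree_except s l x t))"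
    by (intro sum.cong refl sum.swap)
  also have "\<dots> = (\<Sum>l\<le>level k. \<Sum>s\<le>l. real (M s) * real (M l) * real (card {t \<in> cyl R N y. agree_except s l x t}))"
    by (intro sum.cong refl) (simp add: finite_cyl Int_def flip: sum_distrib_left)
  also have "\<dots> \<le> (\<Sum>l\<le>level k. \<Sum>s\<le>l. real (M s) * real (M l) *
      (real (M R) / real (M (max l N)) * of_bool (s \<le> min l N \<and> agree_except s (min l N) x y)))"
    using level_le[OF k(2)] by (intro sum_mono mult_left_mono card_cyl_agree_except_le x) auto
  also have "\<dots> = (\<Sum>l\<le>level k. \<Sum>s\<le>min l N. real (M s) * real (M l) *
      (real (M R) / real (M (max l N)) * of_bool (agree_except s (min l N) x y)))"
    by (intro sum.cong refl sum.mono_neutral_cong_right) auto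
  finally have 1: "(\<Sum>t\<in>cyl R N y. kernel_bd (level k) x t) \<le> \<dots>" .
  have "cmod (T R a k x) \<le> A * C1 / real k * (\<Sum>t\<in>cyl R N y. kernel_bd (level k) x t) / real (M R)"
    by (rule norm_T_le_kernel_bd) (use x k A supp bdd le_M_level in \<open>auto simp: cyl_def\<close>)
  also have "\<dots> \<le> A * C1 / real k * (\<Sum>l\<le>level k. \<Sum>s\<le>min l N. real (M s) * real (M l) *
      (real (M R) / real (M (max l N)) * of_bool (agree_except s (min l N) x y))) / real (M R)"
    using A C1_pos by (intro divide_right_mono mult_left_mono 1) auto
  also have "\<dots> = (\<Sum>l\<le>level k. \<Sum>s\<le>min l N.
    A * C1 / real k * (real (M s) * real (M l) / real (M (max l N))) * of_bool (agree_except s (min l N) x y))"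
    using M_pos[of R] unfolding sum_distrib_left sum_divide_distrib by (intro sum.cong refl) simp
  finally show ?thesis .
qed

text \<open>Subadditivity of the root separates the pairs \<open>s\<close>, \<open>l\<close>, and
  each condition on \<open>x\<close> holds on a set of proportion at most
  \<open>B / M (min l N)\<close>. Summing over \<open>s\<close> cancels this denominator, so every
  \<open>l\<close> contributes equally; their number \<open>level k + 1\<close> is the source of the
  logarithm.\<close>

lemma sum_T_atom_far:
  assumes k: "k \<ge> 1" "k \<le> M R"
  shows "(\<Sum>x\<in>X R - cyl R N y. sqrt (cmod (T R a k x)))
    \<le> sqrt (A * C1 / real k) * (real (level k) + 1) * (4 * real B * real (M R) / sqrt (real (M N)))"
proof -
  define e where "e l s = sqrt (A * C1 / real k) * (sqrt (real (M s)) * sqrt (real (M l) / real (M (max l N))))" for l s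
  have e0: "e l s \<ge> 0" for l s using A C1_pos by (simp add: e_def)
  have "sqrt (cmod (T R a k x)) \<le> (\<Sum>l\<le>level k. \<Sum>s\<le>min l N. e l s * of_bool (agree_except s (min l N) x y))"
    if "x \<in> X R - cyl R N y" for x
  proof -
    have n: "0 \<le> A * C1 / real k * (real (M s) * real (M l) / real (M (max l N))) * of_bool (agree_except s (min l N) x y)" for l s
      using A C1_pos by simp
    have "sqrt (cmod (T R a k x)) \<le> (\<Sum>l\<le>level k. sqrt (\<Sum>s\<le>min l N.
        A * C1 / real k * (real (M s) * real (M l) / real (M (max l N))) * of_bool (agree_except s (min l N) x y)))"
      using that k by (intro order.trans[OF real_sqrt_le_mono[OF T_atom_far] sqrt_sum_le] sum_nonneg n) auto
    also have "\<dots> \<le> (\<Sum>l\<le>level k. \<Sum>s\<le>min l N. sqrt (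
        A * C1 / real k * (real (M s) * real (M l) / real (M (max l N))) * of_bool (agree_except s (min l N) x y)))"
      by (intro sum_mono sqrt_sum_le n) auto
    also have "\<dots> = (\<Sum>l\<le>level k. \<Sum>s\<le>min l N. e l s * of_bool (agree_except s (min l N) x y))"
      by (intro sum.cong refl) (simp add: e_def real_sqrt_mult real_sqrt_divide)
    finally show ?thesis .
  qed
  then have "(\<Sum>x\<in>X R - cyl R N y. sqrt (cmod (T R a k x)))
    \<le> (\<Sum>x\<in>X R - cyl R N y. \<Sum>l\<le>level k. \<Sum>s\<le>min l N. e l s * of_bool (agree_except s (min l N) x y))"
    by (rule sum_mono)
  also have "\<dots> \<le> (\<Sum>x\<in>X R. \<Sum>l\<le>level k. \<Sum>s\<le>min l N. e l s * of_bool (agree_except s (min l N) x y))"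
    by (intro sum_mono2 sum_nonneg mult_nonneg_nonneg e0) (auto simp: finite_X)
  also have "\<dots> = (\<Sum>l\<le>level k. \<Sum>x\<in>X R. \<Sum>s\<le>min l N. e l s * of_bool (agree_except s (min l N) x y))"
    by (rule sum.swap)
  also have "\<dots> = (\<Sum>l\<le>level k. \<Sum>s\<le>min l N. \<Sum>x\<in>X R. e l s * of_bool (agree_except s (min l N) x y))"
    by (intro sum.cong refl sum.swap)
  also have "\<dots> = (\<Sum>l\<le>level k. \<Sum>s\<le>min l N. e l s * real (card {x \<in> X R. agree_except s (min l N) x y}))"
    by (intro sum.cong refl) (simp add: finite_X Int_def flip: sum_distrib_left)
  also have "\<dots> \<le> (\<Sum>l\<le>level k. \<Sum>s\<le>min l N. e l s * (real B * real (M R) / real (M (min l N))))"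
  proof (intro sum_mono mult_left_mono e0)
    fix l s
    have "real (card {x \<in> X R. agree_except s (min l N) x y} * M (min l N)) \<le> real (B * M R)"
      using NR by (intro of_nat_mono card_agree_except_le) simp
    then show "real (card {x \<in> X R. agree_except s (min l N) x y}) \<le> real B * real (M R) / real (M (min l N))"
      using M_pos[of "min l N"] by (simp add: field_simps)
  qed
  also have "\<dots> \<le> (\<Sum>l\<le>level k. sqrt (A * C1 / real k) * (4 * real B * real (M R) / sqrt (real (M N))))"
  proof (rule sum_mono)
    fix l
    define \<mu> where "\<mu> = min l N"
    \<comment> \<open>The minimum and the maximum of \<open>l\<close> and \<open>N\<close> are
      \<open>l\<close> and \<open>N\<close> in some order.\<close>
    have q: "real (M l) / real (M (max l N)) = real (M \<mu>) / real (M N)"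
      using M_pos[of l] M_pos[of N] by (auto simp: \<mu>_def min_def max_def)
    have "(\<Sum>s\<le>\<mu>. e l s * (real B * real (M R) / real (M \<mu>)))
       = (\<Sum>s\<le>\<mu>. sqrt (real (M s))) * (sqrt (A * C1 / real k) * sqrt (real (M \<mu>) / real (M N)) * (real B * real (M R) / real (M \<mu>)))"
      unfolding e_def q sum_distrib_right by (intro sum.cong refl) (simp add: ac_simps)
    also have "\<dots> \<le> (4 * sqrt (real (M \<mu>))) * (sqrt (A * C1 / real k) * sqrt (real (M \<mu>) / real (M N)) * (real B * real (M R) / real (M \<mu>)))"
      using A C1_pos by (intro mult_right_mono sum_sqrt_M_le) auto
    also have "\<dots> = sqrt (A * C1 / real k) * (4 * real B * real (M R) / sqrt (real (M N))) * (sqrt (real (M \<mu>)) * sqrt (real (M \<mu>)) / real (M \<mu>))"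
      by (simp only: real_sqrt_divide) (simp only: times_divide_eq_left times_divide_eq_right divide_divide_eq_left ac_simps)
    also have "sqrt (real (M \<mu>)) * sqrt (real (M \<mu>)) / real (M \<mu>) = 1"
      using M_pos[of \<mu>] by simp
    finally show "(\<Sum>s\<le>min l N. e l s * (real B * real (M R) / real (M (min l N))))
      \<le> sqrt (A * C1 / real k) * (4 * real B * real (M R) / sqrt (real (M N)))"
      by (simp add: \<mu>_def)
  qed
  also have "\<dots> = sqrt (A * C1 / real k) * (real (level k) + 1) * (4 * real B * real (M R) / sqrt (real (M N)))"
    by simp
  finally show ?thesis .
qed

lemma sum_T_atom_near:
  assumes k: "k \<ge> 1" "k \<le> M R"
  shows "(\<Sum>x\<in>cyl R N y. sqrt (cmod (T R a k x))) \<le> sqrt C2 * sqrt A * real (M R) / real (M N)"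
proof -
  have "(\<Sum>x\<in>cyl R N y. sqrt (cmod (T R a k x))) \<le> (\<Sum>x\<in>cyl R N y. sqrt (C2 * A))"
    using k A bdd by (intro sum_mono real_sqrt_le_mono norm_T_le) (auto simp: cyl_def)
  also have "\<dots> = sqrt (C2 * A) * real (card (cyl R N y))" by simp
  also have "\<dots> \<le> sqrt (C2 * A) * (real (M R) / real (M N))"
  proof (intro mult_left_mono)
    have "real (card (cyl R N y) * M N) \<le> real (M R)" by (intro of_nat_mono card_cyl_le NR)
    then show "real (card (cyl R N y)) \<le> real (M R) / real (M N)"
      using M_pos[of N] by (simp add: field_simps)
  qed (use A C2_pos in auto)
  finally show ?thesis by (simp add: real_sqrt_mult)
qed

text \<open>The constant \<open>?c\<close> comes from the supporting interval and meets a harmonic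
  sum. The constant \<open>?d\<close> comes from its complement and meets the tail of the sum of
  k^(-3/2) beyond \<open>M N\<close>, which supplies the second factor 1 / sqrt
  (\<open>M N\<close>).\<close>

lemma Phi_atom_le:
  assumes n: "n \<ge> 2" "n \<le> M R"
  shows "Phi n R a \<le> (3 * sqrt C2 + 40 * real B * sqrt C1) * sqrt A * ln (real n) / real (M N)"
proof -
  have ln: "ln (real n) \<ge> 0" using n by simp
  let ?c = "sqrt C2 * sqrt A / real (M N)"
  let ?d = "20 * real B * sqrt C1 * sqrt A * ln (real n) / sqrt (real (M N))"
  have main: "(\<Sum>x\<in>X R. sqrt (cmod (T R a k x))) / real (M R) / real k
      \<le> ?c * (1 / real k) + ?d * (1 / (real k * sqrt (real k)))" if k: "k \<ge> 1" "k \<le> n" for k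
  proof -
    have kR: "k \<le> M R" using k n by simp
    have "(\<Sum>x\<in>X R. sqrt (cmod (T R a k x)))
      = (\<Sum>x\<in>X R - cyl R N y. sqrt (cmod (T R a k x))) + (\<Sum>x\<in>cyl R N y. sqrt (cmod (T R a k x)))"
      by (intro sum.subset_diff finite_X) (auto simp: cyl_def)
    also have "\<dots> \<le> sqrt (A * C1 / real k) * (5 * ln (real n)) * (4 * real B * real (M R) / sqrt (real (M N)))
        + sqrt C2 * sqrt A * real (M R) / real (M N)"
    proof (intro add_mono sum_T_atom_near k kR)
      have "sqrt (A * C1 / real k) * (real (level k) + 1) * (4 * real B * real (M R) / sqrt (real (M N)))
        \<le> sqrt (A * C1 / real k) * (5 * ln (real n)) * (4 * real B * real (M R) / sqrt (real (M N)))"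
        using level_le_ln[of k n] k n A C1_pos by (intro mult_right_mono mult_left_mono) auto
      then show "(\<Sum>x\<in>X R - cyl R N y. sqrt (cmod (T R a k x)))
        \<le> sqrt (A * C1 / real k) * (5 * ln (real n)) * (4 * real B * real (M R) / sqrt (real (M N)))"
        using sum_T_atom_far[OF k(1) kR] by linarith
    qed
    also have "\<dots> = real (M R) * (?c + ?d * (1 / sqrt (real k)))"
      by (simp add: real_sqrt_mult real_sqrt_divide algebra_simps)
    finally have "(\<Sum>x\<in>X R. sqrt (cmod (T R a k x))) / real (M R) \<le> ?c + ?d * (1 / sqrt (real k))"
      using M_pos[of R] by (simp add: field_simps)
    then have "(\<Sum>x\<in>X R. sqrt (cmod (T R a k x))) / real (M R) / real k \<le> (?c + ?d * (1 / sqrt (real k))) / real k"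
      by (rule divide_right_mono) simp
    also have "\<dots> = ?c * (1 / real k) + ?d * (1 / (real k * sqrt (real k)))"
      by (simp add: add_divide_distrib)
    finally show ?thesis .
  qed
  \<comment> \<open>Indices up to \<open>M N\<close> drop out by the vanishing of the means; without
    this the far part would not decay like \<open>1 / M N\<close>.\<close>
  have "Phi n R a = (\<Sum>k=Suc (M N)..n. (\<Sum>x\<in>X R. sqrt (cmod (T R a k x))) / real (M R) / real k)"
    unfolding Phi_def
    by (rule sum.mono_neutral_right) (auto simp: T_atom_eq_0 not_less_eq_eq)
  also have "\<dots> \<le> (\<Sum>k=Suc (M N)..n. ?c * (1 / real k) + ?d * (1 / (real k * sqrt (real k))))"
    by (intro sum_mono main) auto
  also have "\<dots> = ?c * (\<Sum>k=Suc (M N)..n. 1 / real k) + ?d * (\<Sum>k=Suc (M N)..n. 1 / (real k * sqrt (real k)))"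
    by (simp add: sum.distrib sum_distrib_left)
  also have "\<dots> \<le> ?c * (3 * ln (real n)) + ?d * (2 / sqrt (real (M N)))"
  proof (intro add_mono mult_left_mono)
    have "(\<Sum>k=Suc (M N)..n. 1 / real k) \<le> (\<Sum>k=1..n. 1 / real k)"
      by (rule sum_mono2) auto
    then show "(\<Sum>k=Suc (M N)..n. 1 / real k) \<le> 3 * ln (real n)" using sum_inverse_le_3ln[OF n(1)] by linarith
    show "(\<Sum>k=Suc (M N)..n. 1 / (real k * sqrt (real k))) \<le> 2 / sqrt (real (M N))"
      using M_pos[of N] by (intro sum_three_halves_le) simp
  qed (use A C2_pos C1_pos ln in auto)
  also have "\<dots> = (3 * sqrt C2 + 40 * real B * sqrt C1) * sqrt A * ln (real n) / real (M N)"
    using M_pos[of N] by (simp add: field_simps)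
  finally show ?thesis .
qed

end
end

section \<open>Atomic decomposition by stopping times\<close>

text \<open>The terms grow geometrically with ratio sqrt 2 > 4/3, so the last active one dominates:
  all earlier ones together are at most three times as large.\<close>

lemma sum_dyadic_sqrt_le:
  fixes v \<theta> :: real
  assumes "\<theta> \<ge> 0" "v \<ge> 0"
  shows "(\<Sum>k<K. sqrt (\<theta> * 2 ^ k) * of_bool (\<theta> * 2 ^ k < v)) \<le> 4 * sqrt v"
proof (induction K)
  case (Suc K)
  show ?case
  proof (cases "\<theta> * 2 ^ K < v")
    case True
    have geo: "(\<Sum>k<K. sqrt (\<theta> * 2 ^ k)) \<le> 3 * sqrt (\<theta> * 2 ^ K)" for K
    proof (induction K)
      case (Suc K)
      have "(4 / 3) ^ 2 * (\<theta> * 2 ^ K) \<le> \<theta> * 2 ^ Suc K"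
        using assms by (simp add: power2_eq_square)
      then have "sqrt ((4 / 3) ^ 2 * (\<theta> * 2 ^ K)) \<le> sqrt (\<theta> * 2 ^ Suc K)" by (rule real_sqrt_le_mono)
      then have "4 / 3 * sqrt (\<theta> * 2 ^ K) \<le> sqrt (\<theta> * 2 ^ Suc K)" by (simp add: real_sqrt_mult)
      then show ?case using Suc unfolding sum.lessThan_Suc by linarith
    qed (use assms in simp)
    have "(\<Sum>k<Suc K. sqrt (\<theta> * 2 ^ k) * of_bool (\<theta> * 2 ^ k < v)) \<le> (\<Sum>k<K. sqrt (\<theta> * 2 ^ k)) + sqrt (\<theta> * 2 ^ K)"
      unfolding sum.lessThan_Suc using assms by (intro add_mono sum_mono) auto
    also have "\<dots> \<le> 4 * sqrt (\<theta> * 2 ^ K)" using geo[of K] by linarith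
    also have "\<dots> \<le> 4 * sqrt v" using True by simp
    finally show ?thesis .
  next
    case False
    then show ?thesis using Suc by simp
  qed
qed (use assms in simp)

section \<open>Stopping times and stopped martingales\<close>

context vilenkin
begin

lemma upd_space: "x \<in> vilenkin_space m \<Longrightarrow> j < m n \<Longrightarrow> x(n := j) \<in> vilenkin_space m"
  by (simp add: vilenkin_space_def)

context
  fixes f :: "nat \<Rightarrow> (nat \<Rightarrow> nat) \<Rightarrow> complex" and R :: nat
  assumes mart: "vmartingale m f"
begin

lemma adapted: "x \<in> vilenkin_space m \<Longrightarrow> y \<in> vilenkin_space m \<Longrightarrow> (\<And>j. j < n \<Longrightarrow> x j = y j) \<Longrightarrow> f n x = f n y"
  using mart unfolding vmartingale_def by blast

lemma martingale_avg:
  assumes "x \<in> vilenkin_space m"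
  shows "of_nat (m n) * f n x = (\<Sum>j<m n. f (Suc n) (x(n := j)))"
proof -
  have *: "f n x = (\<Sum>j<m n. f (Suc n) (x(n := j))) / of_nat (m n)"
    using mart assms unfolding vmartingale_def by blast
  show ?thesis by (subst *) (use m_pos[of n] in simp)
qed

text \<open>Looking one step ahead keeps the martingale below the threshold up to and including the stopping time;
  boundedness of \<open>m\<close> makes the stopped set at most \<open>B\<close> times larger than the set where the maximal function is large.\<close>
definition exceeds :: "real \<Rightarrow> nat \<Rightarrow> (nat \<Rightarrow> nat) \<Rightarrow> bool" where
  "exceeds \<theta> n x \<longleftrightarrow> (\<exists>j<m n. cmod (f (Suc n) (x(n := j))) > \<theta>)"

text \<open>The alternative \<open>n = R\<close> guarantees existence and serves as the value for
  points that never trigger the threshold before \<open>R\<close>.\<close>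

definition stop_time :: "real \<Rightarrow> (nat \<Rightarrow> nat) \<Rightarrow> nat" where
  "stop_time \<theta> x = (LEAST n. n = R \<or> exceeds \<theta> n x)"

definition stopped :: "real \<Rightarrow> (nat \<Rightarrow> nat) \<Rightarrow> complex" where
  "stopped \<theta> x = f (stop_time \<theta> x) x"

text \<open>The coordinate \<open>n\<close> is overwritten by every possible value, so the event
  depends only on earlier coordinates although it looks at \<open>f (Suc n)\<close>.\<close>

lemma exceeds_cong:
  assumes "x \<in> vilenkin_space m" "y \<in> vilenkin_space m" "\<And>i. i < n \<Longrightarrow> x i = y i"
  shows "exceeds \<theta> n x \<longleftrightarrow> exceeds \<theta> n y"
proof -
  have "f (Suc n) (x(n := j)) = f (Suc n) (y(n := j))" if "j < m n" for j
    using assms that by (intro adapted upd_space) auto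
  then show ?thesis by (auto simp: exceeds_def)
qed

lemma stop_time_cases: "stop_time \<theta> x = R \<or> exceeds \<theta> (stop_time \<theta> x) x"
  unfolding stop_time_def by (rule LeastI_ex) blast

lemma stop_time_le: "stop_time \<theta> x \<le> R"
  unfolding stop_time_def by (rule Least_le) blast

lemma le_stop_time_iff: "n \<le> stop_time \<theta> x \<longleftrightarrow> (\<forall>i<n. i \<noteq> R \<and> \<not> exceeds \<theta> i x)"
proof
  assume "n \<le> stop_time \<theta> x"
  then have "\<not> (i = R \<or> exceeds \<theta> i x)" if "i < n" for i
    using not_less_Least[of i "\<lambda>n. n = R \<or> exceeds \<theta> n x"] that unfolding stop_time_def by (meson less_le_trans)
  then show "\<forall>i<n. i \<noteq> R \<and> \<not> exceeds \<theta> i x" by blast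
next
  assume "\<forall>i<n. i \<noteq> R \<and> \<not> exceeds \<theta> i x"
  then show "n \<le> stop_time \<theta> x" using stop_time_cases[of \<theta> x] by (metis not_le)
qed

lemma Suc_le_stop_time_cong:
  assumes "x \<in> vilenkin_space m" "y \<in> vilenkin_space m" "\<And>i. i < n \<Longrightarrow> x i = y i"
  shows "Suc n \<le> stop_time \<theta> x \<longleftrightarrow> Suc n \<le> stop_time \<theta> y"
proof -
  have "exceeds \<theta> i x \<longleftrightarrow> exceeds \<theta> i y" if "i < Suc n" for i
    using assms that by (intro exceeds_cong) auto
  then show ?thesis unfolding le_stop_time_iff by blast
qed

lemma stop_time_eq_cong:
  assumes "x \<in> vilenkin_space m" "y \<in> vilenkin_space m" "\<And>i. i < n \<Longrightarrow> x i = y i" "stop_time \<theta> x = n"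
  shows "stop_time \<theta> y = n"
proof -
  have "exceeds \<theta> i x \<longleftrightarrow> exceeds \<theta> i y" if "i < n" for i
    using assms that by (intro exceeds_cong) auto
  moreover have "n \<le> stop_time \<theta> x" using assms by simp
  ultimately have "n \<le> stop_time \<theta> y" unfolding le_stop_time_iff by blast
  moreover have "\<not> Suc n \<le> stop_time \<theta> y" using Suc_le_stop_time_cong[OF assms(1-3), of n \<theta>] assms(4) by simp
  ultimately show ?thesis by simp
qed

lemma stop_time_mono: "\<theta> \<le> \<theta>' \<Longrightarrow> stop_time \<theta> x \<le> stop_time \<theta>' x"
  unfolding le_stop_time_iff
proof (intro allI impI)
  fix i assume "\<theta> \<le> \<theta>'" "i < stop_time \<theta> x"
  moreover from \<open>i < stop_time \<theta> x\<close> have "i \<noteq> R \<and> \<not> exceeds \<theta> i x" using le_stop_time_iff[of "stop_time \<theta> x" \<theta> x] by blast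
  ultimately show "i \<noteq> R \<and> \<not> exceeds \<theta>' i x" by (force simp: exceeds_def)
qed

text \<open>Not having stopped at \<open>n\<close> bounds all continuations to \<open>Suc n\<close>,
  in particular the actual one \<open>j = x n\<close>. The hypothesis on \<open>f 0\<close> covers
  stopping at time 0.\<close>

lemma norm_stopped_le:
  assumes "x \<in> vilenkin_space m" "cmod (f 0 x) \<le> \<theta>"
  shows "cmod (stopped \<theta> x) \<le> \<theta>"
proof (cases "stop_time \<theta> x")
  case (Suc n)
  then have "\<not> exceeds \<theta> n x" using le_stop_time_iff[of "Suc n" \<theta> x] by simp
  moreover have "x n < m n" using assms by (simp add: vilenkin_space_def)
  ultimately have "cmod (f (Suc n) (x(n := x n))) \<le> \<theta>" unfolding exceeds_def using not_le by blast
  then show ?thesis by (simp add: stopped_def Suc)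
qed (use assms in \<open>simp add: stopped_def\<close>)

text \<open>Where stopping occurs at \<open>n\<close>, the stopped function is the constant
  \<open>f n y\<close> on the cylinder. Otherwise all children are still running, and the martingale
  property averages their values, by downward induction from \<open>R\<close>.\<close>

lemma optional_stopping:
  assumes "n \<le> R" "y \<in> vilenkin_space m" "n \<le> stop_time \<theta> y"
  shows "of_nat (M n) * (\<Sum>x\<in>cyl R n y. stopped \<theta> x) = of_nat (M R) * f n y"
proof -
  have stop: "of_nat (M n) * (\<Sum>x\<in>cyl R n y. stopped \<theta> x) = of_nat (M R) * f n y"
    if "n \<le> R" "y \<in> vilenkin_space m" "stop_time \<theta> y = n" for n y
  proof -
    have "stopped \<theta> x = f n y" if x: "x \<in> cyl R n y" for x
    proof -
      have xs: "x \<in> vilenkin_space m" using x X_subset_space by (auto simp: cyl_def)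
      have eq: "y i = x i" if "i < n" for i using x that by (simp add: cyl_def)
      have "stop_time \<theta> x = n"
        by (rule stop_time_eq_cong[OF \<open>y \<in> vilenkin_space m\<close> xs eq \<open>stop_time \<theta> y = n\<close>])
      moreover have "f n y = f n x" by (rule adapted[OF \<open>y \<in> vilenkin_space m\<close> xs eq])
      ultimately show ?thesis by (simp add: stopped_def)
    qed
    then have "(\<Sum>x\<in>cyl R n y. stopped \<theta> x) = of_nat (card (cyl R n y)) * f n y" by simp
    then have "of_nat (M n) * (\<Sum>x\<in>cyl R n y. stopped \<theta> x) = of_nat (card (cyl R n y) * M n) * f n y"
      by simp
    also have "card (cyl R n y) * M n = M R"
      by (rule card_cyl) (use that in \<open>auto simp: vilenkin_space_def\<close>)
    finally show ?thesis .
  qed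
  show ?thesis
    using assms
  proof (induction n arbitrary: y rule: inc_induct)
    case base
    then show ?case using stop_time_le[of \<theta> y] by (intro stop) auto
  next
    case (step n)
    show ?case
    proof (cases "stop_time \<theta> y = n")
      case True
      then show ?thesis using step by (intro stop) auto
    next
      case False
      then have Suc: "Suc n \<le> stop_time \<theta> y" using step by simp
      have IH: "of_nat (M (Suc n)) * (\<Sum>x\<in>cyl R (Suc n) (y(n := j)). stopped \<theta> x) = of_nat (M R) * f (Suc n) (y(n := j))"
        if "j < m n" for j
      proof (rule step.IH)
        show "y(n := j) \<in> vilenkin_space m" using step that by (intro upd_space)
        then show "Suc n \<le> stop_time \<theta> (y(n := j))"
          using Suc_le_stop_time_cong[of y "y(n := j)" n \<theta>] step Suc by simp
      qed
      have "of_nat (m n) * (of_nat (M n) * (\<Sum>x\<in>cyl R n y. stopped \<theta> x))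
          = (\<Sum>j<m n. of_nat (M (Suc n)) * (\<Sum>x\<in>cyl R (Suc n) (y(n := j)). stopped \<theta> x))"
        using step.hyps by (simp add: sum_cyl_split M_Suc sum_distrib_left ac_simps)
      also have "\<dots> = (\<Sum>j<m n. of_nat (M R) * f (Suc n) (y(n := j)))"
        by (intro sum.cong refl IH) simp
      also have "\<dots> = of_nat (m n) * (of_nat (M R) * f n y)"
        using martingale_avg[OF step.prems(1), of n] by (simp add: ac_simps flip: sum_distrib_left)
      finally show ?thesis using m_pos[of n] by simp
    qed
  qed
qed

section \<open>The truncated maximal function and the stopping intervals\<close>

definition max_fun :: "(nat \<Rightarrow> nat) \<Rightarrow> real" where
  "max_fun x = Max ((\<lambda>n. cmod (f n x)) ` {..R})"

lemma norm_le_max_fun: "n \<le> R \<Longrightarrow> cmod (f n x) \<le> max_fun x"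
  unfolding max_fun_def by (rule Max_ge) auto

lemma max_fun_nonneg: "max_fun x \<ge> 0"
  using norm_le_max_fun[of 0 x] norm_ge_zero[of "f 0 x"] by linarith

text \<open>An index set for the intervals on which stopping occurs before \<open>R\<close>; taking
  \<open>y\<close> in \<open>X n\<close> gives each interval a unique label.\<close>

definition stops :: "real \<Rightarrow> (nat \<times> (nat \<Rightarrow> nat)) set" where
  "stops \<theta> = (SIGMA n:{..<R}. {y \<in> X n. stop_time \<theta> y = n})"

lemma finite_stops: "finite (stops \<theta>)"
  by (simp add: stops_def finite_X)

lemma stops_unique:
  assumes "(n, y) \<in> stops \<theta>" "x \<in> cyl R n y"
  shows "n = stop_time \<theta> x" "y = (\<lambda>i. if i < n then x i else 0)"
proof -
  have "y \<in> vilenkin_space m" "x \<in> vilenkin_space m"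
    using assms X_subset_space by (auto simp: stops_def cyl_def)
  moreover have "y i = x i" if "i < n" for i using assms that by (simp add: cyl_def)
  moreover have "stop_time \<theta> y = n" using assms by (simp add: stops_def)
  ultimately have "stop_time \<theta> x = n" by (rule stop_time_eq_cong)
  then show "n = stop_time \<theta> x" by simp
  show "y = (\<lambda>i. if i < n then x i else 0)"
    using assms by (auto simp: stops_def cyl_def X_def fun_eq_iff)
qed

lemma stops_exists:
  assumes x: "x \<in> X R" and n: "stop_time \<theta> x = n" "n < R"
  shows "(n, \<lambda>i. if i < n then x i else 0) \<in> stops \<theta>" "x \<in> cyl R n (\<lambda>i. if i < n then x i else 0)"
proof -
  let ?y = "\<lambda>i. if i < n then x i else 0"
  have y: "?y \<in> X n" using assms by (auto simp: X_def)
  have "x \<in> vilenkin_space m" "?y \<in> vilenkin_space m" using x y X_subset_space by blast+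
  then have "stop_time \<theta> ?y = n" using n(1) by (intro stop_time_eq_cong[of x ?y]) auto
  then show "(n, ?y) \<in> stops \<theta>" using y n by (simp add: stops_def)
  show "x \<in> cyl R n ?y" using x by (simp add: cyl_def)
qed

text \<open>A point stopped before \<open>R\<close> lies in exactly one of the intervals, all others
  in none.\<close>

lemma sum_stops_eq:
  fixes g :: "_ \<Rightarrow> 'a::comm_monoid_add"
  assumes x: "x \<in> X R" and z: "stop_time \<theta> x = R \<Longrightarrow> g x = 0"
  shows "(\<Sum>(n, y)\<in>stops \<theta>. if x \<in> cyl R n y then g x else 0) = g x"
proof (cases "stop_time \<theta> x < R")
  case True
  let ?p = "(stop_time \<theta> x, \<lambda>i. if i < stop_time \<theta> x then x i else 0)"
  have "(\<Sum>(n, y)\<in>stops \<theta>. if x \<in> cyl R n y then g x else 0) = (\<Sum>p\<in>{?p}. g x)"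
  proof (rule sum.mono_neutral_cong_right)
    show "{?p} \<subseteq> stops \<theta>" using stops_exists[OF x refl True] by simp
    show "\<forall>p\<in>stops \<theta> - {?p}. (case p of (n, y) \<Rightarrow> if x \<in> cyl R n y then g x else 0) = 0"
      using stops_unique[of _ _ \<theta> x] by fastforce
    show "(case p of (n, y) \<Rightarrow> if x \<in> cyl R n y then g x else 0) = g x" if "p \<in> {?p}" for p
      using stops_exists[OF x refl True] that by simp
  qed (rule finite_stops)
  then show ?thesis by simp
next
  case False
  then have R: "stop_time \<theta> x = R" using stop_time_le[of \<theta> x] by simp
  then have "g x = 0" by (rule z)
  then show ?thesis unfolding case_prod_beta by (intro trans[OF sum.neutral]) auto
qed

text \<open>Every stopping interval has a child on which the next martingale value exceeds the
  threshold, and this child fills at least the proportion \<open>1 / B\<close> of it. The intervals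
  are disjoint, so these children add up within the set where the maximal function is large.\<close>

lemma sum_stops_card_le:
  "(\<Sum>(n, y)\<in>stops \<theta>. 1 / real (M n)) \<le> real B * real (card {x \<in> X R. \<theta> < max_fun x}) / real (M R)"
proof -
  have one: "real (M R) / real (M n) \<le> real B * real (card {x \<in> cyl R n y. \<theta> < max_fun x})"
    if ny: "(n, y) \<in> stops \<theta>" for n y
  proof -
    have n: "n < R" "stop_time \<theta> y = n" and y: "y \<in> vilenkin_space m"
      using ny X_subset_space by (auto simp: stops_def)
    then have "exceeds \<theta> n y" using stop_time_cases[of \<theta> y] by auto
    then obtain j where j: "j < m n" "\<theta> < cmod (f (Suc n) (y(n := j)))" by (auto simp: exceeds_def)
    have "cyl R (Suc n) (y(n := j)) \<subseteq> {x \<in> cyl R n y. \<theta> < max_fun x}"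
    proof
      fix x assume x: "x \<in> cyl R (Suc n) (y(n := j))"
      then have "x \<in> vilenkin_space m" using X_subset_space by (auto simp: cyl_def)
      then have "f (Suc n) x = f (Suc n) (y(n := j))"
        using x y j by (intro adapted upd_space) (auto simp: cyl_def)
      then have "\<theta> < max_fun x" using j norm_le_max_fun[of "Suc n" x] n by simp
      then show "x \<in> {x \<in> cyl R n y. \<theta> < max_fun x}" using x by (auto simp: cyl_def)
    qed
    then have "card (cyl R (Suc n) (y(n := j))) \<le> card {x \<in> cyl R n y. \<theta> < max_fun x}"
      by (intro card_mono) (auto simp: finite_cyl)
    moreover have "card (cyl R (Suc n) (y(n := j))) * M (Suc n) = M R"
      using n y j by (intro card_cyl) (auto simp: vilenkin_space_def)
    ultimately have "M R \<le> card {x \<in> cyl R n y. \<theta> < max_fun x} * M (Suc n)"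
      by (metis mult_le_mono1)
    also have "\<dots> \<le> card {x \<in> cyl R n y. \<theta> < max_fun x} * (B * M n)"
      by (intro mult_le_mono2 M_Suc_le)
    finally have "real (M R) \<le> real (card {x \<in> cyl R n y. \<theta> < max_fun x} * (B * M n))"
      by (rule of_nat_mono)
    then show ?thesis using M_pos[of n] by (simp add: field_simps)
  qed
  have "real (M R) * (\<Sum>(n, y)\<in>stops \<theta>. 1 / real (M n)) = (\<Sum>(n, y)\<in>stops \<theta>. real (M R) / real (M n))"
    by (simp add: sum_distrib_left case_prod_beta)
  also have "\<dots> \<le> (\<Sum>(n, y)\<in>stops \<theta>. real B * real (card {x \<in> cyl R n y. \<theta> < max_fun x}))"
    by (intro sum_mono) (use one in auto)
  also have "\<dots> = real B * real (\<Sum>p\<in>stops \<theta>. card {x \<in> cyl R (fst p) (snd p). \<theta> < max_fun x})"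
    by (simp add: sum_distrib_left case_prod_beta)
  also have "(\<Sum>p\<in>stops \<theta>. card {x \<in> cyl R (fst p) (snd p). \<theta> < max_fun x})
      = card (\<Union>p\<in>stops \<theta>. {x \<in> cyl R (fst p) (snd p). \<theta> < max_fun x})"
  proof (rule card_UN_disjoint[symmetric])
    show "\<forall>p\<in>stops \<theta>. \<forall>p'\<in>stops \<theta>. p \<noteq> p' \<longrightarrow>
      {x \<in> cyl R (fst p) (snd p). \<theta> < max_fun x} \<inter> {x \<in> cyl R (fst p') (snd p'). \<theta> < max_fun x} = {}"
    proof (intro ballI impI, rule ccontr)
      fix p p' assume p: "p \<in> stops \<theta>" "p' \<in> stops \<theta>" "p \<noteq> p'"
        and "{x \<in> cyl R (fst p) (snd p). \<theta> < max_fun x} \<inter> {x \<in> cyl R (fst p') (snd p'). \<theta> < max_fun x} \<noteq> {}"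
      then obtain x where x: "x \<in> cyl R (fst p) (snd p)" "x \<in> cyl R (fst p') (snd p')" by blast
      have "(fst p, snd p) \<in> stops \<theta>" "(fst p', snd p') \<in> stops \<theta>" using p by simp_all
      note a = stops_unique[OF this(1) x(1)] and b = stops_unique[OF this(2) x(2)]
      have "fst p = fst p'" using a(1) b(1) by simp
      moreover have "snd p = snd p'" using a(2) b(2) \<open>fst p = fst p'\<close> by simp
      ultimately show False using p(3) by (simp add: prod_eq_iff)
    qed
  qed (auto simp: finite_stops finite_cyl)
  also have "\<dots> \<le> card {x \<in> X R. \<theta> < max_fun x}"
    by (intro card_mono) (auto simp: finite_X cyl_def)
  finally have "real (M R) * (\<Sum>(n, y)\<in>stops \<theta>. 1 / real (M n)) \<le> real B * real (card {x \<in> X R. \<theta> < max_fun x})"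
    by (simp add: mult_left_mono)
  then show ?thesis using M_pos[of R] by (simp add: field_simps)
qed

end
end

section \<open>Summing the atomic estimates\<close>

context norlund
begin

lemma Phi_cong: "(\<And>x. x \<in> X R \<Longrightarrow> g x = h x) \<Longrightarrow> Phi n R g = Phi n R h"
  by (simp add: Phi_def T_def)

definition C3 :: real where "C3 = 3 * sqrt C2 + 40 * real B * sqrt C1"

lemma C3_nonneg: "C3 \<ge> 0"
  using C1_pos C2_pos by (simp add: C3_def)

text \<open>The difference of the two stopped functions is restricted to the stopping intervals of
  the lower threshold. Each piece is bounded by \<open>3 * \<theta>\<close> and has mean zero, hence
  is an atom.\<close>

lemma Phi_stopped_diff_le:
  assumes mart: "vmartingale m f" and n: "n \<ge> 2" "n \<le> M R"
    and \<theta>: "\<theta> > 0" "\<And>x. x \<in> X R \<Longrightarrow> cmod (f 0 x) \<le> \<theta>"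
  shows "Phi n R (\<lambda>x. stopped f R (2 * \<theta>) x - stopped f R \<theta> x)
    \<le> 2 * real B * C3 * ln (real n) * (\<Sum>x\<in>X R. sqrt \<theta> * of_bool (\<theta> < max_fun f R x)) / real (M R)"
proof -
  define d where "d x = stopped f R (2 * \<theta>) x - stopped f R \<theta> x" for x
  have sp: "x \<in> X R \<Longrightarrow> x \<in> vilenkin_space m" for x R using X_subset_space by blast
  have d: "cmod (d x) \<le> 3 * \<theta>" if "x \<in> X R" for x
  proof -
    have "cmod (stopped f R (2 * \<theta>) x) \<le> 2 * \<theta>" "cmod (stopped f R \<theta> x) \<le> \<theta>"
      using \<theta>(1) \<theta>(2)[OF that] by (intro norm_stopped_le[OF mart] sp[OF that]; simp)+
    then show ?thesis
      using norm_triangle_ineq4[of "stopped f R (2 * \<theta>) x" "stopped f R \<theta> x"] by (simp add: d_def)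
  qed
  define a where "a p x = (if x \<in> cyl R (fst p) (snd p) then d x else 0)" for p x
  have decomp: "d x = (\<Sum>p\<in>stops f R \<theta>. a p x)" if x: "x \<in> X R" for x
  proof -
    \<comment> \<open>If the lower threshold is not triggered before \<open>R\<close>, neither is
      the higher one, and both stopped functions equal \<open>f R\<close>.\<close>
    have "d x = 0" if "stop_time f R \<theta> x = R"
      using that stop_time_mono[OF mart, of \<theta> "2 * \<theta>" R x] stop_time_le[OF mart, of R "2 * \<theta>" x] \<theta>(1)
      by (simp add: d_def stopped_def[OF mart])
    from sum_stops_eq[where g = d and x = x and \<theta> = \<theta>, OF mart x this] show ?thesis by (simp add: a_def case_prod_beta)
  qed
  have atom: "Phi n R (a p) \<le> C3 * sqrt (3 * \<theta>) * ln (real n) / real (M (fst p))"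
    if p: "p \<in> stops f R \<theta>" for p
  proof -
    obtain k y where ky: "p = (k, y)" by fastforce
    have k: "k < R" "stop_time f R \<theta> y = k" and y: "y \<in> vilenkin_space m"
      using p sp unfolding ky by (auto simp: stops_def[OF mart])
    \<comment> \<open>The higher threshold stops no earlier than \<open>k\<close>, so both stopped
      functions have the same average \<open>f k y\<close> on the interval.\<close>
    have "of_nat (M k) * (\<Sum>x\<in>cyl R k y. d x) = 0"
      using optional_stopping[OF mart, of k R y \<theta>] optional_stopping[OF mart, of k R y "2 * \<theta>"]
        k y stop_time_mono[OF mart, of \<theta> "2 * \<theta>" R y] \<theta>(1)
      by (simp add: d_def sum_subtractf right_diff_distrib)
    then have "(\<Sum>x\<in>cyl R k y. d x) = 0" using M_pos[of k] by simp
    then have "(\<Sum>x\<in>cyl R k y. a p x) = 0" by (simp add: a_def ky)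
    then show ?thesis
      unfolding C3_def ky fst_conv
      using k d \<theta>(1) n by (intro Phi_atom_le[where y = y]) (auto simp: a_def ky)
  qed
  have "Phi n R d = Phi n R (\<lambda>x. \<Sum>p\<in>stops f R \<theta>. a p x)"
    by (rule Phi_cong) (rule decomp)
  also have "\<dots> \<le> (\<Sum>p\<in>stops f R \<theta>. Phi n R (a p))"
    by (rule Phi_sum_le) (rule finite_stops[OF mart])
  also have "\<dots> \<le> (\<Sum>p\<in>stops f R \<theta>. C3 * sqrt (3 * \<theta>) * ln (real n) / real (M (fst p)))"
    by (intro sum_mono atom)
  also have "\<dots> = C3 * sqrt (3 * \<theta>) * ln (real n) * (\<Sum>(k, y)\<in>stops f R \<theta>. 1 / real (M k))"
    by (simp add: sum_distrib_left case_prod_beta)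
  also have "\<dots> \<le> C3 * (2 * sqrt \<theta>) * ln (real n) * (real B * real (card {x \<in> X R. \<theta> < max_fun f R x}) / real (M R))"
  proof (intro mult_mono sum_stops_card_le[OF mart])
    have "sqrt (3 * \<theta>) \<le> sqrt (2 ^ 2 * \<theta>)" using \<theta>(1) by (intro real_sqrt_le_mono) simp
    then show "sqrt (3 * \<theta>) \<le> 2 * sqrt \<theta>" by (simp add: real_sqrt_mult)
  qed (use C3_nonneg \<theta>(1) n in \<open>auto intro!: sum_nonneg\<close>)
  also have "\<dots> = 2 * real B * C3 * ln (real n) * (\<Sum>x\<in>X R. sqrt \<theta> * of_bool (\<theta> < max_fun f R x)) / real (M R)"
    by (simp add: finite_X Int_def flip: sum_distrib_left)
  finally show ?thesis by (simp add: d_def[abs_def])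
qed

definition C4 :: real where "C4 = 3 * sqrt C2 + 8 * real B * C3"

text \<open>Telescoping over the thresholds \<open>\<theta> * 2 ^ k\<close>: the bottom term is
  bounded by \<open>\<theta>\<close> and costs \<open>sqrt \<theta>\<close>, the differences cost
  dyadic sums that add up pointwise to a multiple of the root of the maximal function.\<close>

lemma Phi_martingale_le:
  assumes mart: "vmartingale m f" and n: "n \<ge> 2" "n \<le> M R"
  shows "Phi n R (f R) \<le> C4 * ln (real n) * ((\<Sum>x\<in>X R. sqrt (max_fun f R x)) / real (M R))"
proof -
  define E where "E = (\<Sum>x\<in>X R. sqrt (max_fun f R x)) / real (M R)"
  have sp: "x \<in> X R \<Longrightarrow> x \<in> vilenkin_space m" for x using X_subset_space by blast
  have E0: "E \<ge> 0" by (auto simp: E_def intro!: sum_nonneg divide_nonneg_nonneg max_fun_nonneg[OF mart])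
  show ?thesis
  proof (cases "E = 0")
    case True
    \<comment> \<open>The base threshold would be 0 here, but then \<open>f R\<close> vanishes on
      \<open>X R\<close>.\<close>
    have "sqrt (max_fun f R x) = 0" if "x \<in> X R" for x
    proof -
      have "(\<Sum>x\<in>X R. sqrt (max_fun f R x)) = 0" using True M_pos[of R] by (simp add: E_def)
      then show ?thesis
        using that by (subst (asm) sum_nonneg_eq_0_iff) (auto simp: finite_X max_fun_nonneg[OF mart])
    qed
    then have "cmod (f R x) \<le> 0" if "x \<in> X R" for x
      using norm_le_max_fun[OF mart, of R R x] that by simp
    then have "Phi n R (f R) \<le> 3 * sqrt C2 * sqrt 0 * ln (real n)"
      by (intro Phi_le_sup n) auto
    then show ?thesis unfolding E_def[symmetric] True by simp
  next
    case False
    \<comment> \<open>The base threshold must dominate \<open>f 0\<close>, and \<open>sqrt \<theta>\<close> must be controlled by \<open>E\<close>.\<close>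
    define \<theta> where "\<theta> = E ^ 2"
    have \<theta>: "\<theta> > 0" "sqrt \<theta> = E" using False E0 by (auto simp: \<theta>_def)
    have f0: "cmod (f 0 x) \<le> \<theta>" if x: "x \<in> X R" for x
    proof -
      have "sqrt (cmod (f 0 x)) \<le> sqrt (max_fun f R z)" if "z \<in> X R" for z
      proof -
        \<comment> \<open>\<open>f 0\<close> is constant on the group, so its modulus lies below the
          maximal function everywhere and can be compared with the average \<open>E\<close>.\<close>
        have "f 0 x = f 0 z" by (rule adapted[OF mart sp[OF x] sp[OF that]]) simp
        then show ?thesis using norm_le_max_fun[OF mart, of 0 R z] by simp
      qed
      then have "(\<Sum>z\<in>X R. sqrt (cmod (f 0 x))) \<le> (\<Sum>z\<in>X R. sqrt (max_fun f R z))" by (rule sum_mono)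
      then have "sqrt (cmod (f 0 x)) \<le> E" using M_pos[of R] by (simp add: E_def card_X field_simps)
      then have "sqrt (cmod (f 0 x)) \<le> sqrt \<theta>" by (simp add: \<theta>)
      then show ?thesis by simp
    qed
    define F where "F = Max (max_fun f R ` X R)"
    \<comment> \<open>A threshold above the maximal function on all of \<open>X R\<close> is never
      triggered, so the top stopped function is \<open>f R\<close> itself.\<close>
    obtain K where K: "F / \<theta> < 2 ^ K" using real_arch_pow[of 2 "F / \<theta>"] by auto
    define g where "g k = stopped f R (\<theta> * 2 ^ k)" for k
    have le: "\<theta> \<le> \<theta> * 2 ^ k" for k using \<theta>(1) by simp
    have top: "f R x = g K x" if x: "x \<in> X R" for x
    proof -
      have "\<not> exceeds f (\<theta> * 2 ^ K) i x" if "i < R" for i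
      proof
        assume "exceeds f (\<theta> * 2 ^ K) i x"
        then obtain j where j: "j < m i" "\<theta> * 2 ^ K < cmod (f (Suc i) (x(i := j)))"
          by (auto simp: exceeds_def[OF mart])
        have "x(i := j) \<in> X R" using x j that by (auto simp: X_def)
        then have "max_fun f R (x(i := j)) \<le> F" unfolding F_def by (intro Max_ge) (auto simp: finite_X)
        moreover have "cmod (f (Suc i) (x(i := j))) \<le> max_fun f R (x(i := j))"
          by (rule norm_le_max_fun[OF mart]) (use that in simp)
        ultimately have "\<theta> * 2 ^ K < F" using j by linarith
        then show False using K \<theta>(1) by (simp add: field_simps)
      qed
      then have "R \<le> stop_time f R (\<theta> * 2 ^ K) x" unfolding le_stop_time_iff[OF mart] by auto
      then have "stop_time f R (\<theta> * 2 ^ K) x = R" using stop_time_le[OF mart, of R "\<theta> * 2 ^ K" x] by simp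
      then show ?thesis by (simp add: g_def stopped_def[OF mart])
    qed
    have "Phi n R (f R) = Phi n R (\<lambda>x. \<Sum>k<Suc K. (case k of 0 \<Rightarrow> g 0 x | Suc k \<Rightarrow> g (Suc k) x - g k x))"
    proof (rule Phi_cong)
      fix x assume "x \<in> X R"
      then show "f R x = (\<Sum>k<Suc K. (case k of 0 \<Rightarrow> g 0 x | Suc k \<Rightarrow> g (Suc k) x - g k x))"
        unfolding sum.lessThan_Suc_shift using sum_lessThan_telescope[of "\<lambda>k. g k x" K] by (simp add: top)
    qed
    also have "\<dots> \<le> (\<Sum>k<Suc K. Phi n R (\<lambda>x. case k of 0 \<Rightarrow> g 0 x | Suc k \<Rightarrow> g (Suc k) x - g k x))"
      by (rule Phi_sum_le) simp
    also have "\<dots> = Phi n R (g 0) + (\<Sum>k<K. Phi n R (\<lambda>x. g (Suc k) x - g k x))"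
      unfolding sum.lessThan_Suc_shift by simp
    also have "\<dots> \<le> 3 * sqrt C2 * sqrt \<theta> * ln (real n) + (\<Sum>k<K. 2 * real B * C3 * ln (real n)
        * (\<Sum>x\<in>X R. sqrt (\<theta> * 2 ^ k) * of_bool (\<theta> * 2 ^ k < max_fun f R x)) / real (M R))"
    proof (intro add_mono sum_mono)
      show "Phi n R (g 0) \<le> 3 * sqrt C2 * sqrt \<theta> * ln (real n)"
        using \<theta> f0 n unfolding g_def
        by (intro Phi_le_sup) (auto intro!: norm_stopped_le[OF mart] sp)
      fix k
      have "g (Suc k) x - g k x = stopped f R (2 * (\<theta> * 2 ^ k)) x - stopped f R (\<theta> * 2 ^ k) x" for x
        by (simp add: g_def ac_simps)
      then show "Phi n R (\<lambda>x. g (Suc k) x - g k x) \<le> 2 * real B * C3 * ln (real n)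
        * (\<Sum>x\<in>X R. sqrt (\<theta> * 2 ^ k) * of_bool (\<theta> * 2 ^ k < max_fun f R x)) / real (M R)"
        using Phi_stopped_diff_le[OF mart n, of "\<theta> * 2 ^ k"] \<theta>(1) order.trans[OF f0 le[of k]] by simp
    qed
    also have "(\<Sum>k<K. 2 * real B * C3 * ln (real n)
        * (\<Sum>x\<in>X R. sqrt (\<theta> * 2 ^ k) * of_bool (\<theta> * 2 ^ k < max_fun f R x)) / real (M R))
      = 2 * real B * C3 * ln (real n) * (\<Sum>x\<in>X R. \<Sum>k<K. sqrt (\<theta> * 2 ^ k) * of_bool (\<theta> * 2 ^ k < max_fun f R x)) / real (M R)"
      by (subst sum.swap) (simp add: sum_distrib_left sum_divide_distrib)
    also have "\<dots> \<le> 2 * real B * C3 * ln (real n) * (\<Sum>x\<in>X R. 4 * sqrt (max_fun f R x)) / real (M R)"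
      using C3_nonneg n \<theta>(1) max_fun_nonneg[OF mart]
      by (intro divide_right_mono mult_left_mono sum_mono sum_dyadic_sqrt_le) auto
    also have "3 * sqrt C2 * sqrt \<theta> * ln (real n) + \<dots> = C4 * ln (real n) * E"
      unfolding \<theta>(2) by (simp add: C4_def E_def algebra_simps flip: sum_distrib_left)
    finally show ?thesis by (simp add: E_def)
  qed
qed

end

section \<open>Haar integrals of cylinder functions\<close>

context vilenkin
begin

lemma space_haar: "space (haar m) = vilenkin_space m"
  by (simp add: haar_def space_PiM PiE_UNIV_domain space_uniform_count_measure vilenkin_space_def Pi_def)

lemma prob_space_haar: "prob_space (haar m)"
proof -
  have "{..<m k} \<noteq> {}" for k using m_pos[of k] by auto
  then show ?thesis unfolding haar_def
    by (intro prob_space_PiM prob_space_uniform_count_measure) auto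
qed

lemma sets_haar_cylinder: "{x \<in> space (haar m). \<forall>i<n. x i = y i} \<in> sets (haar m)"
proof -
  have "(\<lambda>x. x i) \<in> measurable (haar m) (count_space UNIV)" for i
  proof -
    have "(\<lambda>x. x i) \<in> measurable (haar m) (uniform_count_measure {..<m i})"
      unfolding haar_def by (rule measurable_component_singleton) simp
    moreover have "(\<lambda>x. x) \<in> measurable (uniform_count_measure {..<m i}) (count_space UNIV)"
      by (simp add: measurable_def sets_uniform_count_measure space_uniform_count_measure)
    ultimately show ?thesis by (rule measurable_compose)
  qed
  then show ?thesis by measurable
qed

lemma measure_haar_cylinder:
  assumes y: "y \<in> vilenkin_space m"
  shows "measure (haar m) {x \<in> space (haar m). \<forall>i<n. x i = y i} = 1 / real (M n)"
proof -
  have ne: "{..<m k} \<noteq> {}" for k using m_pos[of k] by auto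
  interpret product_prob_space "\<lambda>k. uniform_count_measure {..<m k}" UNIV
    by (intro product_prob_spaceI prob_space_uniform_count_measure ne) simp
  have "emeasure (haar m) {x \<in> space (haar m). \<forall>i\<in>{..<n}. x i \<in> {y i}}
      = (\<Prod>i<n. emeasure (uniform_count_measure {..<m i}) {y i})"
    unfolding haar_def using y
    by (intro emeasure_PiM_Collect) (auto simp: sets_uniform_count_measure vilenkin_space_def)
  also have "\<dots> = (\<Prod>i<n. ennreal (1 / real (m i)))"
    using y by (intro prod.cong refl) (simp add: emeasure_uniform_count_measure vilenkin_space_def)
  also have "\<dots> = ennreal (\<Prod>i<n. 1 / real (m i))"
    by (rule prod_ennreal) simp
  also have "(\<Prod>i<n. 1 / real (m i)) = 1 / real (M n)"
    by (simp add: Mseq_def prod_dividef)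
  finally show ?thesis by (simp add: measure_def lessThan_def)
qed

text \<open>Such a function is a finite combination of indicators of cylinders of order
  \<open>R\<close>, all of the same measure.\<close>

lemma
  fixes g :: "(nat \<Rightarrow> nat) \<Rightarrow> 'b::{banach, second_countable_topology}"
  assumes g: "\<And>x y. x \<in> vilenkin_space m \<Longrightarrow> y \<in> vilenkin_space m \<Longrightarrow> (\<And>i. i < R \<Longrightarrow> x i = y i) \<Longrightarrow> g x = g y"
  shows integrable_haar: "integrable (haar m) g"
    and integral_haar: "(\<integral>x. g x \<partial>haar m) = (\<Sum>y\<in>X R. g y) /\<^sub>R real (M R)"
proof -
  define C where "C y = {x \<in> space (haar m). \<forall>i<R. x i = y i}" for y
  interpret prob_space "haar m" by (rule prob_space_haar)
  have C: "C y \<in> sets (haar m)" for y unfolding C_def by (rule sets_haar_cylinder)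
  have eq: "g x = (\<Sum>y\<in>X R. indicator (C y) x *\<^sub>R g y)" if x: "x \<in> space (haar m)" for x
  proof -
    let ?y = "\<lambda>i. if i < R then x i else 0"
    have xs: "x \<in> vilenkin_space m" using x by (simp add: space_haar)
    then have y: "?y \<in> X R" by (auto simp: X_def vilenkin_space_def)
    have "(\<Sum>y\<in>X R. indicator (C y) x *\<^sub>R g y) = (\<Sum>y\<in>{?y}. g y)"
    proof (rule sum.mono_neutral_cong_right)
      show "\<forall>z\<in>X R - {?y}. indicator (C z) x *\<^sub>R g z = 0"
      proof
        fix z assume z: "z \<in> X R - {?y}"
        then have "z \<noteq> ?y" by simp
        then obtain i where i: "z i \<noteq> ?y i" by blast
        then have "i < R" using z by (auto simp: X_def split: if_splits)
        then have "x \<notin> C z" using i by (auto simp: C_def)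
        then show "indicator (C z) x *\<^sub>R g z = 0" by simp
      qed
      show "indicator (C z) x *\<^sub>R g z = g z" if "z \<in> {?y}" for z
        using that x by (simp add: C_def)
    qed (use y in \<open>auto simp: finite_X\<close>)
    also have "(\<Sum>y\<in>{?y}. g y) = g x"
      using g[of x ?y] xs y X_subset_space[of R] by auto
    finally show ?thesis by simp
  qed
  have i1: "integrable (haar m) (\<lambda>x. indicator (C y) x *\<^sub>R g y)" for y
    using C[of y] by (intro integrable_scaleR_left) (simp add: emeasure_eq_measure)
  have "integrable (haar m) (\<lambda>x. \<Sum>y\<in>X R. indicator (C y) x *\<^sub>R g y)"
    by (intro Bochner_Integration.integrable_sum i1)
  then show "integrable (haar m) g" by (subst Bochner_Integration.integrable_cong[OF refl eq])
  have "(\<integral>x. g x \<partial>haar m) = (\<integral>x. (\<Sum>y\<in>X R. indicator (C y) x *\<^sub>R g y) \<partial>haar m)"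
    by (rule Bochner_Integration.integral_cong[OF refl eq])
  also have "\<dots> = (\<Sum>y\<in>X R. \<integral>x. indicator (C y) x *\<^sub>R g y \<partial>haar m)"
    by (rule Bochner_Integration.integral_sum) (rule i1)
  also have "\<dots> = (\<Sum>y\<in>X R. measure (haar m) (C y) *\<^sub>R g y)"
  proof (rule sum.cong[OF refl])
    fix y assume "y \<in> X R"
    have "integrable (haar m) (indicator (C y) :: _ \<Rightarrow> real)" using C[of y] by (simp add: emeasure_eq_measure)
    then have "(\<integral>x. indicator (C y) x *\<^sub>R g y \<partial>haar m) = (\<integral>x. indicator (C y) x \<partial>haar m) *\<^sub>R g y"
      by (intro integral_scaleR_left) simp
    also have "(\<integral>x. indicator (C y) x \<partial>haar m) = measure (haar m) (C y)"
      using C[of y] sets.sets_into_space[OF C[of y]] by (simp add: Int_absorb2)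
    finally show "(\<integral>x. indicator (C y) x *\<^sub>R g y \<partial>haar m) = measure (haar m) (C y) *\<^sub>R g y" .
  qed
  also have "\<dots> = (\<Sum>y\<in>X R. inverse (real (M R)) *\<^sub>R g y)"
  proof (rule sum.cong[OF refl])
    fix y assume "y \<in> X R"
    then have "measure (haar m) (C y) = 1 / real (M R)"
      unfolding C_def using X_subset_space by (intro measure_haar_cylinder) blast
    then show "measure (haar m) (C y) *\<^sub>R g y = inverse (real (M R)) *\<^sub>R g y" by (simp add: inverse_eq_divide)
  qed
  finally show "(\<integral>x. g x \<partial>haar m) = (\<Sum>y\<in>X R. g y) /\<^sub>R real (M R)"
    by (simp add: scaleR_sum_right)
qed

section \<open>Fourier coefficients, partial sums and norms in the finite model\<close>

lemma psi_cong: "i < M R \<Longrightarrow> (\<And>j. j < R \<Longrightarrow> x j = y j) \<Longrightarrow> psi m i x = psi m i y"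
  unfolding psi_eq_chi by (rule chi_cong) (auto simp: rk_def)

text \<open>The integrals in the defining limit are constant from \<open>R\<close> on: the character
  ignores later coordinates, and averaging over these turns \<open>f (Suc k)\<close> into
  \<open>f k\<close>.\<close>

lemma fourier_coeff_eq:
  assumes mart: "vmartingale m f" and i: "i < M R"
  shows "fourier_coeff m f i = (\<Sum>t\<in>X R. f R t * cnj (psi m i t)) / of_nat (M R)"
proof -
  define S where "S k = (\<Sum>t\<in>X k. f k t * cnj (psi m i t)) / of_nat (M k)" for k
  have int: "(\<integral>x. f k x * cnj (psi m i x) \<partial>haar m) = S k" if "R \<le> k" for k
  proof -
    have ik: "i < M k" using i M_mono[OF that] by simp
    have "(\<integral>x. f k x * cnj (psi m i x) \<partial>haar m) = (\<Sum>x\<in>X k. f k x * cnj (psi m i x)) /\<^sub>R real (M k)"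
    proof (rule integral_haar)
      fix x y assume xy: "x \<in> vilenkin_space m" "y \<in> vilenkin_space m" "\<And>i. i < k \<Longrightarrow> x i = y i"
      have "f k x = f k y" by (rule adapted[OF mart xy])
      moreover have "psi m i x = psi m i y" by (rule psi_cong[OF ik xy(3)])
      ultimately show "f k x * cnj (psi m i x) = f k y * cnj (psi m i y)" by simp
    qed
    then show ?thesis
      by (simp add: S_def scaleR_conv_of_real divide_inverse mult.commute)
  qed
  have S: "S k = S R" if "R \<le> k" for k
    using that
  proof (induction k rule: dec_induct)
    case (step k)
    have ik: "i < M k" using i M_mono[OF step.hyps(1)] by simp
    have "(\<Sum>t\<in>X (Suc k). f (Suc k) t * cnj (psi m i t))
        = (\<Sum>t\<in>X k. \<Sum>j<m k. f (Suc k) (t(k := j)) * cnj (psi m i (t(k := j))))"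
      by (rule sum_X_Suc)
    also have "\<dots> = (\<Sum>t\<in>X k. of_nat (m k) * (f k t * cnj (psi m i t)))"
    proof (rule sum.cong[OF refl])
      fix t assume t: "t \<in> X k"
      have "psi m i (t(k := j)) = psi m i t" for j by (rule psi_cong[OF ik]) simp
      then have "(\<Sum>j<m k. f (Suc k) (t(k := j)) * cnj (psi m i (t(k := j))))
        = (\<Sum>j<m k. f (Suc k) (t(k := j))) * cnj (psi m i t)"
        by (simp add: sum_distrib_right)
      also have "(\<Sum>j<m k. f (Suc k) (t(k := j))) = of_nat (m k) * f k t"
        using martingale_avg[OF mart, of t k] t X_subset_space by force
      finally show "(\<Sum>j<m k. f (Suc k) (t(k := j)) * cnj (psi m i (t(k := j))))
        = of_nat (m k) * (f k t * cnj (psi m i t))" by (simp only: mult.assoc)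
    qed
    finally have "S (Suc k) = S k"
      using m_pos[of k] by (simp add: S_def M_Suc flip: sum_distrib_left)
    then show ?case using step by simp
  qed simp
  have "(\<lambda>k. \<integral>x. f k x * cnj (psi m i x) \<partial>haar m) \<longlonglongrightarrow> S R"
    by (rule tendsto_eventually, rule eventually_sequentiallyI[of R]) (rule trans[OF int S])
  then show ?thesis unfolding fourier_coeff_def by (simp add: limI S_def)
qed

lemma partial_sum_eq:
  assumes mart: "vmartingale m f" and j: "j \<le> M R"
  shows "partial_sum m f j x = (\<Sum>t\<in>X R. f R t * dirichlet (rk_quot x t) j) / of_nat (M R)"
proof -
  have "partial_sum m f j x = (\<Sum>i<j. \<Sum>t\<in>X R. f R t * chi (rk_quot x t) i / of_nat (M R))"
    unfolding partial_sum_def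
  proof (rule sum.cong[OF refl])
    fix i assume "i \<in> {..<j}"
    then have "i < M R" using j by simp
    show "fourier_coeff m f i * psi m i x = (\<Sum>t\<in>X R. f R t * chi (rk_quot x t) i / of_nat (M R))"
      unfolding fourier_coeff_eq[OF mart \<open>i < M R\<close>] sum_divide_distrib sum_distrib_right
      by (simp add: chi_rk_quot ac_simps)
  qed
  also have "\<dots> = (\<Sum>t\<in>X R. \<Sum>i<j. f R t * chi (rk_quot x t) i / of_nat (M R))" by (rule sum.swap)
  finally show ?thesis by (simp add: dirichlet_def sum_distrib_left sum_divide_distrib)
qed

lemma lp_norm_half_eq:
  assumes g: "\<And>x y. x \<in> vilenkin_space m \<Longrightarrow> y \<in> vilenkin_space m \<Longrightarrow> (\<And>i. i < R \<Longrightarrow> x i = y i) \<Longrightarrow> g x = g y"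
  shows "lp_norm m (1/2) g powr (1/2) = (\<Sum>x\<in>X R. sqrt (cmod (g x))) / real (M R)"
proof -
  have "(\<integral>x. cmod (g x) powr (1/2) \<partial>haar m) = (\<Sum>x\<in>X R. cmod (g x) powr (1/2)) /\<^sub>R real (M R)"
  proof (rule integral_haar)
    fix x y assume "x \<in> vilenkin_space m" "y \<in> vilenkin_space m" "\<And>i. i < R \<Longrightarrow> x i = y i"
    then have "g x = g y" by (rule g)
    then show "cmod (g x) powr (1/2) = cmod (g y) powr (1/2)" by simp
  qed
  then have "(\<integral>x. cmod (g x) powr (1/2) \<partial>haar m) = (\<Sum>x\<in>X R. sqrt (cmod (g x))) / real (M R)"
    by (simp only: powr_half_sqrt[OF norm_ge_zero] real_scaleR_def) (simp only: divide_inverse mult.commute)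
  moreover have "(\<Sum>x\<in>X R. sqrt (cmod (g x))) \<ge> 0" by (intro sum_nonneg) auto
  ultimately show ?thesis unfolding lp_norm_def by (simp add: powr_powr)
qed

lemma max_fun_cong:
  assumes mart: "vmartingale m f"
    and "x \<in> vilenkin_space m" "y \<in> vilenkin_space m" "\<And>i. i < R \<Longrightarrow> x i = y i"
  shows "max_fun f R x = max_fun f R y"
proof -
  have "f n x = f n y" if "n \<le> R" for n
    using that assms by (intro adapted[OF mart]) auto
  then have "(\<lambda>n. cmod (f n x)) ` {..R} = (\<lambda>n. cmod (f n y)) ` {..R}" by (intro image_cong) auto
  then show ?thesis by (simp add: max_fun_def[OF mart])
qed

lemma sum_sqrt_max_fun_le:
  assumes f: "in_Hp m (1/2) f"
  shows "(\<Sum>x\<in>X R. sqrt (max_fun f R x)) / real (M R) \<le> hp_norm m (1/2) f powr (1/2)"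
proof -
  have mart: "vmartingale m f" and fin: "hp_integral m (1/2) f < \<infinity>"
    using f by (auto simp: in_Hp_def)
  have cong: "sqrt (max_fun f R x) = sqrt (max_fun f R y)"
    if "x \<in> vilenkin_space m" "y \<in> vilenkin_space m" "\<And>i. i < R \<Longrightarrow> x i = y i" for x y
  proof -
    have "max_fun f R x = max_fun f R y" by (rule max_fun_cong[OF mart that])
    then show ?thesis by simp
  qed
  define E where "E = (\<Sum>x\<in>X R. sqrt (max_fun f R x)) / real (M R)"
  have E: "(\<integral>x. sqrt (max_fun f R x) \<partial>haar m) = E"
  proof -
    have "(\<integral>x. sqrt (max_fun f R x) \<partial>haar m) = (\<Sum>x\<in>X R. sqrt (max_fun f R x)) /\<^sub>R real (M R)"
      by (rule integral_haar) (rule cong)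
    then show ?thesis by (simp add: E_def divide_inverse mult.commute)
  qed
  have int: "integrable (haar m) (\<lambda>x. sqrt (max_fun f R x))"
    by (rule integrable_haar) (rule cong)
  have "ennreal E = (\<integral>\<^sup>+x. ennreal (sqrt (max_fun f R x)) \<partial>haar m)"
    unfolding E[symmetric]
    by (rule nn_integral_eq_integral[OF int, symmetric])
       (auto simp: max_fun_nonneg[OF mart])
  also have "\<dots> \<le> hp_integral m (1/2) f"
    unfolding hp_integral_def
  proof (rule nn_integral_mono)
    fix x
    have "max_fun f R x \<in> (\<lambda>n. cmod (f n x)) ` {..R}"
      unfolding max_fun_def[OF mart] by (rule Max_in) auto
    then obtain n where "max_fun f R x = cmod (f n x)" by blast
    then have "ennreal (sqrt (max_fun f R x)) = ennreal (cmod (f n x) powr (1/2))"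
      by (simp add: powr_half_sqrt)
    then show "ennreal (sqrt (max_fun f R x)) \<le> (SUP n. ennreal (cmod (f n x) powr (1/2)))"
      by (simp only:) (rule SUP_upper, simp)
  qed
  \<comment> \<open>Finiteness of the integral matters, since \<open>enn2real\<close> sends infinity
    to 0.\<close>
  finally have "E \<le> enn2real (hp_integral m (1/2) f)"
    using fin by (metis enn2real_mono enn2real_ennreal E_def divide_nonneg_nonneg max_fun_nonneg[OF mart]
        of_nat_0_le_iff real_sqrt_ge_zero sum_nonneg infinity_ennreal_def)
  then show ?thesis by (simp add: hp_norm_def powr_powr E_def)
qed

end

section \<open>Passage to the Noerlund means of a martingale\<close>

context norlund
begin

lemma norlund_mean_eq_T:
  assumes mart: "vmartingale m f" and k: "k \<le> M R"
  shows "norlund_mean m q f k x = T R (f R) k x"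
proof -
  have "(\<Sum>j=1..k. of_real (q (k - j)) * partial_sum m f j x)
    = (\<Sum>j=1..k. \<Sum>t\<in>X R. of_real (q (k - j)) * (f R t * dirichlet (rk_quot x t) j) / of_nat (M R))"
    using k by (intro sum.cong refl) (simp add: partial_sum_eq[OF mart, of _ R] sum_distrib_left sum_divide_distrib)
  also have "\<dots> = (\<Sum>t\<in>X R. \<Sum>j=1..k. of_real (q (k - j)) * (f R t * dirichlet (rk_quot x t) j) / of_nat (M R))"
    by (rule sum.swap)
  finally show ?thesis
    unfolding norlund_mean_def T_def norlund_kernel_def
    by (simp add: sum_distrib_left sum_divide_distrib ac_simps)
qed

lemma T_cong:
  assumes "k \<le> M R" "\<And>i. i < R \<Longrightarrow> x i = y i"
  shows "T R g k x = T R g k y"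
proof -
  have "dirichlet (rk_quot x t) j = dirichlet (rk_quot y t) j" if "j \<le> k" for j t
    unfolding dirichlet_def
  proof (rule sum.cong[OF refl])
    fix i assume "i \<in> {..<j}"
    then show "chi (rk_quot x t) i = chi (rk_quot y t) i"
      using that assms by (intro chi_cong[of i R]) (auto simp: rk_quot_def rk_def)
  qed
  then show ?thesis by (simp add: T_def norlund_kernel_def)
qed

text \<open>The horizon \<open>R = n\<close> suffices, since \<open>n \<le> M n\<close> means that
  all \<open>t_k f\<close> with \<open>k \<le> n\<close> depend on the first \<open>n\<close>
  coordinates only.\<close>

lemma strong_summability:
  assumes f: "in_Hp m (1/2) f" and n: "n \<ge> 2"
  shows "(1 / ln (real n)) * (\<Sum>k=1..n. lp_norm m (1/2) (norlund_mean m q f k) powr (1/2) / real k)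
     \<le> C4 * hp_norm m (1/2) f powr (1/2)"
proof -
  have mart: "vmartingale m f" using f by (simp add: in_Hp_def)
  have nR: "n \<le> M n" using less_M[of n] by simp
  have "lp_norm m (1/2) (norlund_mean m q f k) powr (1/2) = (\<Sum>x\<in>X n. sqrt (cmod (T n (f n) k x))) / real (M n)"
    if "k \<le> n" for k
  proof -
    have k: "k \<le> M n" using that nR by simp
    have "norlund_mean m q f k = T n (f n) k" using norlund_mean_eq_T[OF mart k] by blast
    then show ?thesis
      by (simp only:) (rule lp_norm_half_eq, rule T_cong[OF k])
  qed
  then have "(\<Sum>k=1..n. lp_norm m (1/2) (norlund_mean m q f k) powr (1/2) / real k) = Phi n n (f n)"
    unfolding Phi_def by (intro sum.cong refl) simp
  also have "\<dots> \<le> C4 * ln (real n) * ((\<Sum>x\<in>X n. sqrt (max_fun f n x)) / real (M n))"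
    by (rule Phi_martingale_le[OF mart n nR])
  also have "\<dots> \<le> C4 * ln (real n) * hp_norm m (1/2) f powr (1/2)"
    using n C2_pos C3_nonneg by (intro mult_left_mono sum_sqrt_max_fun_le f) (auto simp: C4_def)
  finally show ?thesis using n by (simp add: field_simps)
qed

end

theorem theorem1:
  fixes m :: "nat \<Rightarrow> nat" and q :: "nat \<Rightarrow> real"
  assumes m_ge2: "\<And>k. m k \<ge> 2"
    and m_bdd: "\<exists>B. \<forall>k. m k \<le> B"
    and q_mono: "mono q"
    and q_nonneg: "\<And>k. q k \<ge> 0"
    and q0: "q 0 > 0"
    and Q_lim: "filterlim (Qsum q) at_top sequentially"
    and q_cond: "(\<lambda>n. q (n - 1) / Qsum q n) \<in> O(\<lambda>n. 1 / real n)"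
  shows "\<exists>c. \<forall>f. in_Hp m (1/2) f \<longrightarrow> (\<forall>n\<ge>2.
           (1 / ln (real n)) * (\<Sum>k=1..n. lp_norm m (1/2) (norlund_mean m q f k) powr (1/2) / real k)
             \<le> c * hp_norm m (1/2) f powr (1/2))"
proof -
  obtain B where B: "\<And>k. m k \<le> B" using m_bdd by blast
  obtain c N where c: "\<And>n. n \<ge> N \<Longrightarrow> norm (q (n - 1) / Qsum q n) \<le> c * norm (1 / real n)"
    using landau_o.bigE[OF q_cond] unfolding eventually_sequentially by metis
  \<comment> \<open>The asymptotic condition becomes one for all \<open>n \<ge> 1\<close>: for the
    finitely many \<open>n < N\<close> the quotient is at most 1, hence at most N / n.\<close>
  have ratio: "q (n - 1) / Qsum q n \<le> max c (real N) / real n" if n: "n \<ge> 1" for n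
  proof (cases "n \<ge> N")
    case True
    have "\<bar>q (n - 1) / Qsum q n\<bar> \<le> c * \<bar>1 / real n\<bar>"
      using c[OF True] by (simp only: real_norm_def)
    then have "q (n - 1) / Qsum q n \<le> c * \<bar>1 / real n\<bar>" by (rule abs_le_D1)
    also have "\<dots> = c / real n" by simp
    also have "\<dots> \<le> max c (real N) / real n" by (intro divide_right_mono) auto
    finally show ?thesis .
  next
    case False
    have "q (n - 1) \<le> Qsum q n"
      unfolding Qsum_def by (rule member_le_sum) (use n q_nonneg in auto)
    moreover have "Qsum q n \<ge> 0" unfolding Qsum_def by (intro sum_nonneg q_nonneg)
    ultimately have "q (n - 1) / Qsum q n \<le> 1" by (auto simp: divide_le_eq_1)
    also have "1 \<le> real N / real n" using False n by simp
    also have "\<dots> \<le> max c (real N) / real n" by (intro divide_right_mono) auto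
    finally show ?thesis .
  qed
  interpret norlund m B q "max c (real N)"
    by unfold_locales (use m_ge2 B q_mono q_nonneg q0 ratio in auto)
  \<comment> \<open>The witness \<open>C4\<close> depends on \<open>B\<close> and the constant of
    the ratio bound, not on \<open>f\<close> or \<open>n\<close>.\<close>
  show ?thesis using strong_summability by blast
qed

end
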